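(* Let $a$ and the components $(U_i(\omega))_{i\in I_0}$ satisfy assumptions (A1), (A2), (A3), (S1), (S2), (S3) listed in the context. Then for each $i\in I$ there exists a deterministic, $1$-positively homogeneous, continuous function (effective Hamiltonian) $\overline H_i:\mathbb R^n\to\mathbb R$ such that: (i) if $U_i(\omega)$ is bounded, then $\overline H_i\equiv 0$; (ii) if $U_i(\omega)$ is unbounded and $i\in I^+$, then $\overline H_i$ is convex, nonnegative and, for almost every $\omega$ and all $p\in\mathbb R^n$, $$\overline H_i(p)=\inf\Big\{\operatorname*{ess\,sup}_{y\in U_i(\omega)}\big(a(y,\omega)|p+Dw(y)|\big)\ :\ (w,\lambda)\in \mathcal S^+\times(0,\infty),\ \ w+p\cdot y\in\mathcal L_\lambda(U_i(\omega))\Big\};$$ (iii) if $U_i(\omega)$ is unbounded and $i\in I^-$, then $\overline H_i$ is concave, nonpositive and, for almost every $\omega$ and all $p\in\mathbb R^n$, $$\overline H_i(p)=\sup\Big\{\operatorname*{ess\,inf}_{y\in U_i(\omega)}\big(a(y,\omega)|p+Dw(y)|\big)\ :\ (w,\lambda)\in \mathcal S^-\times(0,\infty),\ \ w+p\cdot y\in\mathcal L_\lambda(U_i(\omega))\Big\}.$$ Here $w+p\cdot y$ denotes the function $y\mapsto w(y)+p\cdot y$.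
   Context: Random setting. $(\Omega,\mathcal F,\mathbb P)$ is a probability space with an ergodic group of measure preserving transformations $(\tau_z)_{z\in\mathbb R^n}$, $\tau_z:\Omega\to\Omega$: $\tau_{z+z'}=\tau_z\circ\tau_{z'}$, $\mathbb P[\tau_z\mathcal V]=\mathbb P[\mathcal V]$ for all $\mathcal V\in\mathcal F$, and if $\tau_z(\mathcal V)=\mathcal V$ for every $z\in\mathbb R^n$ then $\mathbb P[\mathcal V]\in\{0,1\}$. The function $a:\mathbb R^n\times\Omega\to\mathbb R$ is measurable with respect to the $\sigma$-algebra generated by $\mathcal B\times\mathcal F$ ($\mathcal B$ the Borel $\sigma$-algebra of $\mathbb R^n$). Assumptions on $a$. (A1) $a(y,\tau_z\omega)=a(y+z,\omega)$ for all $y,z\in\mathbb R^n$, $\omega\in\Omega$. (A2) The family $(a(\cdot,\omega))_{\omega\in\Omega}$ is equi-bounded and equi-Lipschitz with constant $L>0$: $|a(y,\omega)-a(z,\omega)|\le L|y-z|$. (A3) For each $\omega$, $a(\cdot,\omega)$ changes sign. Components. $(U_i(\omega))_{i\in I^+}$ are the connected components of $\{a(\cdot,\omega)>0\}$ and $(U_i(\omega))_{i\in I^-}$ those of $\{a(\cdot,\omega)<0\}$, with $\partial U_i(\omega)\subset U_0(\omega):=\{x: a(x,\omega)=0\}$; $I:=I^+\cup I^-$, $I_0:=I\cup\{0\}$. For $\delta>0$, $U_i^\delta(\omega):=\{x\in U_i(\omega):|a(x,\omega)|>\delta\}$. Assumptions on the components. (S1) There are measurable sets $\mathcal U_i\subset\Omega$,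 $i\in I_0$, with $\mathbb P[\mathcal U_0]=\theta_0\ge0$, $\mathbb P[\mathcal U_i]=\theta_i>0$ for $i\in I$, and $U_i(\omega)=\{x\in\mathbb R^n:\tau_x\omega\in\mathcal U_i\}$ for each $\omega$. (S2) For each $\omega\in\Omega$ and all $i\in I$, $U_i(\omega)$ is $\delta$-connected, that is, there exists $\delta_0>0$ such that, for every $\delta\in(0,\delta_0)$, $U_i^\delta(\omega)$ is connected. (S3) If $U_i(\omega)$ with $i\in I$ is unbounded, then, for every $\delta\in(0,\delta_0)$ and every unit vector $y\in\mathbb R^n$, there exists an (at most) countable family of random intervals $\big((s_j(\omega),t_j(\omega))\big)_{j=1}^\infty$, which depend on $y$ and $\delta$, so that $\{t\ge0: ty\notin U_i^\delta(\omega)\}=\bigcup_{j=1}^\infty(s_j(\omega),t_j(\omega))$ and, uniformly in $y$ and $\delta$, $\lim_{j\to\infty}s_j(\omega)/t_j(\omega)=1$ a.s. in $\omega$. Function classes. $\mathcal L$ is the class of Lipschitz functions on $\mathbb R^n$. For $\mu>0$ and a component $U(\omega)$ of $\{a(\cdot,\omega)\ne0\}$, with $U^\delta(\omega):=\{x\in U(\omega):|a(x,\omega)|>\delta\}$, $\mathcal S_\mu(U(\omega))$ is the class of functions $w$ such that for each $\eta>0$ sufficiently small there exists $\overline\delta=\overline\delta(\eta)>0$, independent of $\omega$, with $\lim_{\eta\to0}\overline\delta(\eta)=0$ and $|w(y_1)-w(y_2)|\le(\mu/\delta+\eta)|y_1-y_2|$ for all $\delta\in(0,\overline\delta)$ and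 $y_1,y_2\in U^\delta(\omega)$. $\mathcal L_\mu(U(\omega)):=\mathcal L\cap\mathcal S_\mu(U(\omega))$. $\mathcal S^+:=\{w\in\mathcal L:\liminf_{|y|\to\infty}w(y)/|y|\ge0\}$, $\mathcal S^-:=\{w\in\mathcal L:\limsup_{|y|\to\infty}w(y)/|y|\le0\}$. *)

theory Defs
  imports "HOL-Probability.Probability"
begin

definition delta_part :: "((real^'n) \<Rightarrow> real) \<Rightarrow> (real^'n) set \<Rightarrow> real \<Rightarrow> (real^'n) set" where
  "delta_part f V \<delta> = {x \<in> V. \<bar>f x\<bar> > \<delta>}"

text \<open>The group acts on \<^term>\<open>space M\<close>, so every condition on \<^term>\<open>\<tau>\<close> is restricted to that set.
  No joint measurability of \<^term>\<open>\<tau>\<close> in both arguments is required.\<close>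

locale ergodic_group = prob_space M for M :: "'w measure" +
  fixes \<tau> :: "real^'n \<Rightarrow> 'w \<Rightarrow> 'w"
  assumes maps_to: "\<And>z \<omega>. \<omega> \<in> space M \<Longrightarrow> \<tau> z \<omega> \<in> space M"
    and zero: "\<And>\<omega>. \<omega> \<in> space M \<Longrightarrow> \<tau> 0 \<omega> = \<omega>"
    and add: "\<And>z z' \<omega>. \<omega> \<in> space M \<Longrightarrow> \<tau> (z + z') \<omega> = \<tau> z (\<tau> z' \<omega>)"
    and sets_image: "\<And>z V. V \<in> sets M \<Longrightarrow> \<tau> z ` V \<in> sets M"
    and preserving: "\<And>z V. V \<in> sets M \<Longrightarrow> prob (\<tau> z ` V) = prob V"
    and ergodic: "\<And>V. V \<in> sets M \<Longrightarrow> (\<And>z. \<tau> z ` V = V) \<Longrightarrow> prob V = 0 \<or> prob V = 1"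

locale stationary_velocity = ergodic_group M \<tau>
  for M :: "'w measure" and \<tau> :: "real^'n \<Rightarrow> 'w \<Rightarrow> 'w" +
  fixes a :: "real^'n \<Rightarrow> 'w \<Rightarrow> real" and L :: real
  assumes measurable_a: "(\<lambda>(y, \<omega>). a y \<omega>) \<in> borel_measurable (borel \<Otimes>\<^sub>M M)"
    and stationary: "\<And>y z \<omega>. \<omega> \<in> space M \<Longrightarrow> a y (\<tau> z \<omega>) = a (y + z) \<omega>"
    and equi_bounded: "\<exists>C. \<forall>\<omega>\<in>space M. \<forall>y. \<bar>a y \<omega>\<bar> \<le> C"
    and L_pos: "L > 0"
    and equi_lipschitz: "\<And>\<omega>. \<omega> \<in> space M \<Longrightarrow> L-lipschitz_on UNIV (\<lambda>y. a y \<omega>)"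
    and changes_sign: "\<And>\<omega>. \<omega> \<in> space M \<Longrightarrow> (\<exists>x. a x \<omega> > 0) \<and> (\<exists>x. a x \<omega> < 0)"

text \<open>\<^term>\<open>Ip\<close> and \<^term>\<open>Im\<close> index the positive and the negative components, and the index \<open>0\<close> the zero
  set. The assumptions force \<open>Ip\<close>, \<open>Im\<close> and \<open>{0}\<close> to be disjoint, because components are
  nonempty, and \<open>Ip\<close> and \<open>Im\<close> to be countable. The threshold \<^term>\<open>\<delta>0\<close> may depend on
  the component and on the realization; it is a parameter because \<open>delta_connected\<close> and
  \<open>rays\<close> refer to the same threshold.

  In \<open>rays\<close>, \<open>s y \<delta> j\<close> and \<open>t y \<delta> j\<close> are the endpoints of the random intervals. The set of
  times at which the ray is outside the (open) set \<open>delta_part\<close> is closed in the half line, so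
  it cannot be equal to a nonempty union of bounded open intervals. The two inclusions say that it
  is the union of the intervals up to their endpoints; this covers open, half-open and closed
  intervals. Degenerate intervals \<open>s = t\<close> are admitted, so that a finite family is the same as
  a sequence that ends in copies of \<open>s = t = 1\<close>.\<close>

locale component_medium = stationary_velocity M \<tau> a L
  for M :: "'w measure" and \<tau> :: "real^'n \<Rightarrow> 'w \<Rightarrow> 'w"
    and a :: "real^'n \<Rightarrow> 'w \<Rightarrow> real" and L :: real +
  fixes Ip Im :: "'i::zero set"
    and U :: "'i \<Rightarrow> 'w \<Rightarrow> (real^'n) set"
    and \<U> :: "'i \<Rightarrow> 'w set"
    and \<theta> :: "'i \<Rightarrow> real"
    and \<delta>0 :: "'i \<Rightarrow> 'w \<Rightarrow> real"
  assumes zero_set: "\<And>\<omega>. \<omega> \<in> space M \<Longrightarrow> U 0 \<omega> = {x. a x \<omega> = 0}"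
    and pos_components: "\<And>\<omega>. \<omega> \<in> space M \<Longrightarrow>
          bij_betw (\<lambda>i. U i \<omega>) Ip (components {x. a x \<omega> > 0})"
    and neg_components: "\<And>\<omega>. \<omega> \<in> space M \<Longrightarrow>
          bij_betw (\<lambda>i. U i \<omega>) Im (components {x. a x \<omega> < 0})"
    and frontier_components: "\<And>i \<omega>. i \<in> Ip \<union> Im \<Longrightarrow> \<omega> \<in> space M \<Longrightarrow>
          frontier (U i \<omega>) \<subseteq> U 0 \<omega>"
    and sets_\<U>: "\<And>i. i \<in> insert 0 (Ip \<union> Im) \<Longrightarrow> \<U> i \<in> sets M"
    and prob_\<U>: "\<And>i. i \<in> insert 0 (Ip \<union> Im) \<Longrightarrow> prob (\<U> i) = \<theta> i"
    and \<theta>_zero: "\<theta> 0 \<ge> 0"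
    and \<theta>_pos: "\<And>i. i \<in> Ip \<union> Im \<Longrightarrow> \<theta> i > 0"
    and U_stationary: "\<And>i \<omega>. i \<in> insert 0 (Ip \<union> Im) \<Longrightarrow> \<omega> \<in> space M \<Longrightarrow>
          U i \<omega> = {x. \<tau> x \<omega> \<in> \<U> i}"
    and \<delta>0_pos: "\<And>i \<omega>. i \<in> Ip \<union> Im \<Longrightarrow> \<omega> \<in> space M \<Longrightarrow> \<delta>0 i \<omega> > 0"
    and delta_connected: "\<And>i \<omega> \<delta>. i \<in> Ip \<union> Im \<Longrightarrow> \<omega> \<in> space M \<Longrightarrow> 0 < \<delta> \<Longrightarrow> \<delta> < \<delta>0 i \<omega> \<Longrightarrow>
          connected (delta_part (\<lambda>y. a y \<omega>) (U i \<omega>) \<delta>)"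
    and rays: "\<And>i. i \<in> Ip \<union> Im \<Longrightarrow>
          \<exists>s t :: real^'n \<Rightarrow> real \<Rightarrow> nat \<Rightarrow> 'w \<Rightarrow> real.
            (\<forall>y \<delta> j. random_variable borel (s y \<delta> j) \<and> random_variable borel (t y \<delta> j)) \<and>
            (\<forall>\<omega>\<in>space M. \<not> bounded (U i \<omega>) \<longrightarrow>
              (\<forall>y \<delta>. norm y = 1 \<and> 0 < \<delta> \<and> \<delta> < \<delta>0 i \<omega> \<longrightarrow>
                (\<forall>j. 0 \<le> s y \<delta> j \<omega> \<and> s y \<delta> j \<omega> \<le> t y \<delta> j \<omega>) \<and>
                (\<Union>j. {s y \<delta> j \<omega> <..< t y \<delta> j \<omega>})
                  \<subseteq> {r. r \<ge> 0 \<and> r *\<^sub>R y \<notin> delta_part (\<lambda>x. a x \<omega>) (U i \<omega>) \<delta>} \<and>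
                {r. r \<ge> 0 \<and> r *\<^sub>R y \<notin> delta_part (\<lambda>x. a x \<omega>) (U i \<omega>) \<delta>}
                  \<subseteq> (\<Union>j. {s y \<delta> j \<omega> .. t y \<delta> j \<omega>}))) \<and>
            (AE \<omega> in M. \<not> bounded (U i \<omega>) \<longrightarrow>
              uniform_limit {(y, \<delta>). norm y = 1 \<and> 0 < \<delta> \<and> \<delta> < \<delta>0 i \<omega>}
                (\<lambda>j (y, \<delta>). s y \<delta> j \<omega> / t y \<delta> j \<omega>) (\<lambda>_. 1) sequentially)"

definition Lip :: "((real^'n) \<Rightarrow> real) set" where
  "Lip = {w. \<exists>C. C-lipschitz_on UNIV w}"

text \<open>Below, \<^term>\<open>f\<close> is one realization \<open>a(\<cdot>, \<omega>)\<close> and \<^term>\<open>V\<close> one of its components. The class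
  \<open>S_mu\<close> consists of functions on the space alone, so for a fixed realization the bound \<open>d\<close>
  on \<open>\<delta>\<close> is just a function of \<open>\<eta>\<close>.\<close>

definition S_mu :: "real \<Rightarrow> ((real^'n) \<Rightarrow> real) \<Rightarrow> (real^'n) set \<Rightarrow> ((real^'n) \<Rightarrow> real) set" where
  "S_mu \<mu> f V = {w. \<exists>\<eta>0>0. \<exists>d :: real \<Rightarrow> real. (d \<longlongrightarrow> 0) (at_right 0) \<and>
     (\<forall>\<eta>. 0 < \<eta> \<and> \<eta> < \<eta>0 \<longrightarrow> d \<eta> > 0 \<and>
       (\<forall>\<delta>. 0 < \<delta> \<and> \<delta> < d \<eta> \<longrightarrow>
         (\<forall>y1 \<in> delta_part f V \<delta>. \<forall>y2 \<in> delta_part f V \<delta>.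
            \<bar>w y1 - w y2\<bar> \<le> (\<mu> / \<delta> + \<eta>) * norm (y1 - y2))))}"

definition L_mu :: "real \<Rightarrow> ((real^'n) \<Rightarrow> real) \<Rightarrow> (real^'n) set \<Rightarrow> ((real^'n) \<Rightarrow> real) set" where
  "L_mu \<mu> f V = Lip \<inter> S_mu \<mu> f V"

definition S_plus :: "((real^'n) \<Rightarrow> real) set" where
  "S_plus = {w \<in> Lip. Liminf at_infinity (\<lambda>y. ereal (w y / norm y)) \<ge> 0}"

definition S_minus :: "((real^'n) \<Rightarrow> real) set" where
  "S_minus = {w \<in> Lip. Limsup at_infinity (\<lambda>y. ereal (w y / norm y)) \<le> 0}"

text \<open>At a point where \<^term>\<open>w\<close> is not differentiable, \<open>grad w\<close> has an unspecified value. Lipschitz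
  functions are differentiable almost everywhere, so essential bounds do not see these values.\<close>

definition grad :: "((real^'n) \<Rightarrow> real) \<Rightarrow> real^'n \<Rightarrow> real^'n" where
  "grad w y = (THE D. GDERIV w y :> D)"

definition essinf :: "'a measure \<Rightarrow> ('a \<Rightarrow> ereal) \<Rightarrow> ereal" where
  "essinf M f = - esssup M (\<lambda>x. - f x)"

end

theory Submission
  imports Defs
begin

text \<open>The condition in the class \<open>S_mu\<close> is vacuous for Lipschitz functions (take small \<open>\<delta>\<close>), so the
  formula minimizes over all of \<open>S_plus\<close>. By Rademacher's theorem, the essential bound by \<open>c\<close> of
  \<open>a \<bar>p + Dw\<bar>\<close> on the component is the same as a local Lipschitz bound with weight \<open>c / a\<close> for
  \<open>u = w + p \<bullet> y\<close>. Among all such \<open>u\<close> that are \<open>K\<close>-Lipschitz and vanish at the origin there is a largest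
  one, the distance that is generated by chains in a countable dense set. Hence the value of the formula
  is below a given number iff for some \<open>K\<close> this distance stays asymptotically above the plane
  \<open>p \<bullet> y\<close>. This is a measurable event, invariant under translations, so it has probability 0 or 1 by
  ergodicity. Since the value is a sublinear, uniformly Lipschitz function of \<open>p\<close>, countably many \<open>p\<close>
  suffice. Negative components reduce to positive ones by passing to \<open>-a\<close>, \<open>-w\<close> and \<open>-p\<close>.\<close>

section \<open>Differentiability of monotone functions on the line\<close>

text \<open>The obstacle is measurability: the formula is an infimum over an uncountable class of
  functions, and \<open>\<tau>\<close> is not known to be jointly measurable. Everything is
  therefore reduced to countably many point evaluations of \<open>a\<close> and of the membership
  \<open>x \<in> U i \<omega>\<close>. This dictates the form of \<open>admissible\<close>. Along
  the segment from \<open>x\<close> to \<open>y\<close> the speed is at least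
  \<open>b x - L * dist x y\<close>, so the gradient bound integrates to an inequality between
  values at two points, free of gradients and path integrals, and letting \<open>y\<close> tend to
  \<open>x\<close> gives the gradient bound back without loss. The component is traded for a speed
  on the whole space by extending \<open>a\<close> by zero; since \<open>a\<close> vanishes on the
  frontier, the Lipschitz constant \<open>L\<close> survives. The gradient bound says nothing where
  the speed vanishes, so the Lipschitz constant \<open>K\<close> of a competitor enters as a
  separate parameter. It has no a priori bound, which is why a union over natural numbers
  \<open>K\<close> remains in the events.\<close>

lemma Vitali_intervals:
  fixes S G :: "real set"
  assumes "open G" "S \<subseteq> G"
    and P: "\<And>x d. x \<in> S \<Longrightarrow> 0 < d \<Longrightarrow> \<exists>a b. a < b \<and> x \<in> {a..b} \<and> b - a < d \<and> P a b"
  obtains C :: "(real \<times> real) set" where "countable C"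
    "\<And>a b. (a, b) \<in> C \<Longrightarrow> a < b \<and> {a..b} \<subseteq> G \<and> P a b"
    "disjoint_family_on (\<lambda>(a, b). {a..b}) C"
    "negligible (S - (\<Union>(a, b)\<in>C. {a..b}))"
proof -
  define K where "K = {(a, b). a < b \<and> {a..b} \<subseteq> G \<and> P a b}"
  \<comment> \<open>On the line, closed intervals are the closed balls given by midpoint and half
    length, the form in which the covering theorem takes them.\<close>
  define m r :: "real \<times> real \<Rightarrow> real" where "m = (\<lambda>(a, b). (a + b) / 2)" and "r = (\<lambda>(a, b). (b - a) / 2)"
  have cb: "cball (m z) (r z) = (case z of (a, b) \<Rightarrow> {a..b})" for z
    by (auto simp: m_def r_def cball_def dist_real_def split: prod.splits) (auto simp: abs_if field_simps split: if_splits)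
  have 1: "0 < r z" if "z \<in> K" for z
    using that by (auto simp: K_def r_def)
  have 2: "\<exists>i. i \<in> K \<and> x \<in> cball (m i) (r i) \<and> r i < d" if x: "x \<in> S" and d: "0 < d" for x d
  proof -
    obtain e where e: "e > 0" "ball x e \<subseteq> G"
      using assms x openE by blast
    obtain a b where ab: "a < b" "x \<in> {a..b}" "b - a < min d e" "P a b"
      using P[OF x, of "min d e"] d e by auto
    have "{a..b} \<subseteq> ball x e"
      using ab by (auto simp: dist_real_def)
    then have "(a, b) \<in> K"
      using ab e by (auto simp: K_def)
    moreover have "x \<in> cball (m (a, b)) (r (a, b))"
      using ab(2) by (simp add: cb)
    moreover have "r (a, b) < d"
      using ab by (simp add: r_def)
    ultimately show ?thesis by blast
  qed
  from Vitali_covering_theorem_cballs[of K r S m, OF 1 2] obtain C where C: "countable C" "C \<subseteq> K"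
     "pairwise (\<lambda>i j. disjnt (cball (m i) (r i)) (cball (m j) (r j))) C"
     "negligible(S - (\<Union>i \<in> C. cball (m i) (r i)))" by blast
  show ?thesis
  proof
    show "countable C" by fact
    show "a < b \<and> {a..b} \<subseteq> G \<and> P a b" if "(a, b) \<in> C" for a b
      using that C(2) by (auto simp: K_def)
    show "disjoint_family_on (\<lambda>(a, b). {a..b}) C"
      using C(3) unfolding cb by (simp add: disjoint_family_on_def pairwise_def disjnt_def)
    show "negligible (S - (\<Union>(a, b)\<in>C. {a..b}))"
      using C(4) unfolding cb by simp
  qed
qed

text \<open>For continuous \<open>f\<close> both sets in the intersection are countable intersections of open sets, so
  measurability does not need a restriction to rational increments.\<close>

definition osc_set :: "('a::real_normed_vector \<Rightarrow> real) \<Rightarrow> 'a \<Rightarrow> real \<Rightarrow> real \<Rightarrow> 'a set" where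
  "osc_set f v p q =
    (\<Inter>n. \<Union>h\<in>{h. h \<noteq> 0 \<and> \<bar>h\<bar> < 1 / Suc n}. {x. (f (x + h *\<^sub>R v) - f x) / h < p}) \<inter>
    (\<Inter>n. \<Union>h\<in>{h. h \<noteq> 0 \<and> \<bar>h\<bar> < 1 / Suc n}. {x. (f (x + h *\<^sub>R v) - f x) / h > q})"

lemma sets_osc_set:
  assumes "continuous_on UNIV f"
  shows "osc_set f v p q \<in> sets borel"
proof -
  have *: "continuous_on UNIV (\<lambda>x. (f (x + h *\<^sub>R v) - f x) / h)" if "h \<noteq> 0" for h
    using that by (intro continuous_intros continuous_on_compose2[OF assms]) auto
  have 1: "open (\<Union>h\<in>{h. h \<noteq> 0 \<and> \<bar>h\<bar> < e}. {x. (f (x + h *\<^sub>R v) - f x) / h < p})" for e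
    using * by (intro open_UN ballI open_Collect_less continuous_on_const) auto
  have 2: "open (\<Union>h\<in>{h. h \<noteq> 0 \<and> \<bar>h\<bar> < e}. {x. (f (x + h *\<^sub>R v) - f x) / h > q})" for e
    using * by (intro open_UN ballI open_Collect_less continuous_on_const) auto
  show ?thesis
    unfolding osc_set_def using borel_open[OF 1] borel_open[OF 2]
    by (intro sets.Int sets.countable_INT') auto
qed

lemma osc_set_approx:
  assumes "x \<in> osc_set f v p q" "0 < d"
  shows "\<exists>h. h \<noteq> 0 \<and> \<bar>h\<bar> < d \<and> (f (x + h *\<^sub>R v) - f x) / h < p"
    and "\<exists>h. h \<noteq> 0 \<and> \<bar>h\<bar> < d \<and> (f (x + h *\<^sub>R v) - f x) / h > q"
proof -
  obtain n where n: "1 / Suc n < d"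
    using assms(2) nat_approx_posE by blast
  from assms(1) obtain h where "h \<noteq> 0" "\<bar>h\<bar> < 1 / Suc n" "(f (x + h *\<^sub>R v) - f x) / h < p"
    unfolding osc_set_def by blast
  with n show "\<exists>h. h \<noteq> 0 \<and> \<bar>h\<bar> < d \<and> (f (x + h *\<^sub>R v) - f x) / h < p"
    using less_trans by blast
  from assms(1) obtain h where "h \<noteq> 0" "\<bar>h\<bar> < 1 / Suc n" "(f (x + h *\<^sub>R v) - f x) / h > q"
    unfolding osc_set_def by blast
  with n show "\<exists>h. h \<noteq> 0 \<and> \<bar>h\<bar> < d \<and> (f (x + h *\<^sub>R v) - f x) / h > q"
    using less_trans by blast
qed

text \<open>Without a limit, two rationals fit strictly between the finite lower and upper limits.
  Failure of convergence is thus a countable union over rational pairs, and a null set for each pair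
  suffices.\<close>

lemma bounded_tendsto_or_oscillates:
  fixes Q :: "real \<Rightarrow> real"
  assumes "\<And>h. \<bar>Q h\<bar> \<le> K"
    and no: "\<And>p q. p \<in> \<rat> \<Longrightarrow> q \<in> \<rat> \<Longrightarrow> p < q \<Longrightarrow> \<not> ((\<exists>\<^sub>F h in at 0. Q h < p) \<and> (\<exists>\<^sub>F h in at 0. Q h > q))"
  obtains D where "(Q \<longlongrightarrow> D) (at 0)"
proof -
  let ?L = "Liminf (at 0) (\<lambda>h. ereal (Q h))" and ?U = "Limsup (at 0) (\<lambda>h. ereal (Q h))"
  have LU: "?L \<le> ?U" by (intro Liminf_le_Limsup) simp
  have K1: "ereal (- K) \<le> ?L"
    using assms(1) by (intro Liminf_bounded always_eventually allI) (simp add: abs_le_iff minus_le_iff)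
  have K2: "?U \<le> ereal K"
    using assms(1) by (intro Limsup_bounded always_eventually allI) (simp add: abs_le_iff)
  have "\<not> ?L < ?U"
  proof
    assume lt: "?L < ?U"
    obtain l u where l: "?L = ereal l" and u: "?U = ereal u"
      using K1 K2 LU by (cases ?L; cases ?U) auto
    then have "l < u" using lt by simp
    obtain p where p: "p \<in> \<rat>" "l < p" "p < u" using Rats_dense_in_real[OF \<open>l < u\<close>] by blast
    obtain q where q: "q \<in> \<rat>" "p < q" "q < u" using Rats_dense_in_real[OF \<open>p < u\<close>] by blast
    have "\<exists>\<^sub>F h in at 0. Q h < p"
    proof (rule ccontr)
      assume "\<not> ?thesis"
      then have "\<forall>\<^sub>F h in at 0. ereal p \<le> ereal (Q h)"
        by (simp add: not_frequently not_less)
      from Liminf_bounded[OF this] show False using l p by simp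
    qed
    moreover have "\<exists>\<^sub>F h in at 0. Q h > q"
    proof (rule ccontr)
      assume "\<not> ?thesis"
      then have "\<forall>\<^sub>F h in at 0. ereal (Q h) \<le> ereal q"
        by (simp add: not_frequently not_less)
      from Limsup_bounded[OF this] show False using u q by simp
    qed
    ultimately show False using no p q by blast
  qed
  with LU have eq: "?U = ?L" by auto
  then obtain l where l: "?L = ereal l" using K1 K2 by (cases ?L) auto
  have "((\<lambda>h. ereal (Q h)) \<longlongrightarrow> ereal l) (at 0)"
    using l eq by (intro Liminf_eq_Limsup) auto
  then show ?thesis by (intro that[of l]) simp
qed

text \<open>The Vitali argument. Inside an open set barely larger than the exceptional set, choose
  disjoint intervals of slope below \<open>p\<close>; inside these, disjoint intervals of slope
  above \<open>q\<close>. Both families exhaust the exceptional set up to null sets. Comparing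
  Lebesgue with Stieltjes measure, \<open>q\<close> times its measure is at most \<open>p\<close>
  times its measure plus a small error. Positive slopes let the comparison run in
  \<open>ennreal\<close>.\<close>

lemma osc_set_real_negligible:
  fixes f :: "real \<Rightarrow> real"
  assumes mono: "mono f" and cont: "continuous_on UNIV f" and pq: "p < q" and p: "p > 0"
  shows "negligible (osc_set f 1 p q)"
proof -
  define \<mu> where "\<mu> = interval_measure f"
  have [measurable_cong, simp]: "sets \<mu> = sets borel" by (simp add: \<mu>_def)
  have cont': "continuous_on A f" for A using cont continuous_on_subset by blast
  have icc: "emeasure \<mu> {a..b} = ennreal (f b - f a)" if "a \<le> b" for a b
    unfolding \<mu>_def using that mono cont'
    by (intro emeasure_interval_measure_Icc) (auto simp: mono_def)
  have S0: "osc_set f 1 p q \<in> sets borel" by (rule sets_osc_set[OF cont])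
  \<comment> \<open>Increments \<open>h\<close> of either sign become slopes of intervals that have
    \<open>x\<close> as an endpoint.\<close>
  have quot: "\<exists>a b. a < b \<and> x \<in> {a..b} \<and> b - a < d \<and> R ((f b - f a) / (b - a))"
    if "h \<noteq> 0" "\<bar>h\<bar> < d" "R ((f (x + h *\<^sub>R 1) - f x) / h)" for x h d R
  proof (cases "h > 0")
    case True
    then show ?thesis using that by (intro exI[of _ x] exI[of _ "x + h"]) auto
  next
    case False
    have "(f x - f (x + h)) / (x - (x + h)) = (f (x + h) - f x) / h"
      using that(1) by (simp add: field_simps)
    with False show ?thesis using that by (intro exI[of _ "x + h"] exI[of _ x]) auto
  qed
  \<comment> \<open>Truncation makes the measure finite, so that it can be cancelled at the
    end.\<close>
  define E where "E M = osc_set f 1 p q \<inter> {-M<..<M}" for M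
  have E[measurable]: "E M \<in> sets borel" for M using S0 by (auto simp: E_def)
  have null: "emeasure lborel (E M) = 0" for M
  proof -
    have "emeasure lborel (E M) \<le> emeasure lborel {-M..M}"
      by (intro emeasure_mono) (auto simp: E_def)
    also have "\<dots> < \<infinity>" by (simp add: emeasure_lborel_Icc_eq)
    finally have fin: "emeasure lborel (E M) < \<infinity>" .
    have main: "ennreal q * emeasure lborel (E M) \<le> ennreal p * (emeasure lborel (E M) + ennreal e)"
      if "e > 0" for e
    proof -
      have "emeasure (lborel :: real measure) (E M) \<noteq> \<infinity>" using fin by auto
      from outer_regular_lborel[OF E \<open>0 < e\<close>, of M] obtain G where G: "open G" "E M \<subseteq> G" "emeasure lborel (G - E M) < e"
        by blast
      have Gle: "emeasure lborel G \<le> emeasure lborel (E M) + ennreal e"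
      proof -
        have "emeasure lborel G = emeasure lborel (E M \<union> (G - E M))"
          using G by (intro arg_cong2[where f=emeasure]) auto
        also have "\<dots> \<le> emeasure lborel (E M) + emeasure lborel (G - E M)"
          using G(1) by (intro emeasure_subadditive) (auto intro: borel_open)
        also have "\<dots> \<le> emeasure lborel (E M) + ennreal e"
          using G(3) by (intro add_left_mono) auto
        finally show ?thesis .
      qed
      have cov1: "\<exists>a b. a < b \<and> x \<in> {a..b} \<and> b - a < d \<and> (f b - f a) / (b - a) < p"
        if "x \<in> E M" "0 < d" for x d
      proof -
        from osc_set_approx(1)[of x f 1 p q d] that obtain h where
          "h \<noteq> 0" "\<bar>h\<bar> < d" "(f (x + h *\<^sub>R 1) - f x) / h < p" by (auto simp: E_def)
        from quot[OF this(1,2), of "\<lambda>z. z < p", OF this(3)] show ?thesis .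
      qed
      obtain C where C: "countable C"
        "\<And>a b. (a, b) \<in> C \<Longrightarrow> a < b \<and> {a..b} \<subseteq> G \<and> (f b - f a) / (b - a) < p"
        "disjoint_family_on (\<lambda>(a, b). {a..b}) C"
        "negligible (E M - (\<Union>(a, b)\<in>C. {a..b}))"
        using Vitali_intervals[where P = "\<lambda>a b. (f b - f a) / (b - a) < p", OF G(1,2) cov1] by blast
      \<comment> \<open>Endpoints are dropped so that the second covering takes place in an open
        set; there are countably many of them.\<close>
      define G' where "G' = (\<Union>(a, b)\<in>C. {a<..<b})"
      have G'o: "open G'" unfolding G'_def by auto
      have "emeasure \<mu> G' \<le> emeasure \<mu> (\<Union>(a, b)\<in>C. {a..b})"
        unfolding G'_def using C(1) by (intro emeasure_mono sets.countable_UN') (force simp: split_beta)+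
      also have "\<dots> = (\<integral>\<^sup>+ z. emeasure \<mu> (case z of (a, b) \<Rightarrow> {a..b}) \<partial>count_space C)"
        using C(1,3) by (intro emeasure_UN_countable) auto
      also have "\<dots> \<le> (\<integral>\<^sup>+ z. ennreal p * emeasure lborel (case z of (a, b) \<Rightarrow> {a..b}) \<partial>count_space C)"
      proof (intro nn_integral_mono)
        fix z assume "z \<in> space (count_space C)"
        then obtain a b where z: "z = (a, b)" "(a, b) \<in> C" by (cases z) auto
        with C(2)[of a b] have ab: "a < b" "f b - f a \<le> p * (b - a)" by (auto simp: field_simps)
        then show "emeasure \<mu> (case z of (a, b) \<Rightarrow> {a..b}) \<le> ennreal p * emeasure lborel (case z of (a, b) \<Rightarrow> {a..b})"
          using p z by (auto simp: icc ennreal_mult[symmetric] intro!: ennreal_leI)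
      qed
      also have "\<dots> = ennreal p * (\<integral>\<^sup>+ z. emeasure lborel (case z of (a, b) \<Rightarrow> {a..b}) \<partial>count_space C)"
        by (intro nn_integral_cmult) auto
      also have "(\<integral>\<^sup>+ z. emeasure lborel (case z of (a, b) \<Rightarrow> {a..b}) \<partial>count_space C) = emeasure lborel (\<Union>(a, b)\<in>C. {a..b})"
        using C(1,3) by (intro emeasure_UN_countable[symmetric]) auto
      also have "emeasure lborel (\<Union>(a, b)\<in>C. {a..b}) \<le> emeasure lborel G"
        using C(2) G(1) by (intro emeasure_mono) (auto intro: borel_open)
      finally have le1: "emeasure \<mu> G' \<le> ennreal p * (emeasure lborel (E M) + ennreal e)"
        using Gle mult_left_mono order_trans by (metis zero_le)
      have cov2: "\<exists>a b. a < b \<and> x \<in> {a..b} \<and> b - a < d \<and> (f b - f a) / (b - a) > q"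
        if "x \<in> E M \<inter> G'" "0 < d" for x d
      proof -
        from osc_set_approx(2)[of x f 1 p q d] that obtain h where
          "h \<noteq> 0" "\<bar>h\<bar> < d" "(f (x + h *\<^sub>R 1) - f x) / h > q" by (auto simp: E_def)
        from quot[OF this(1,2), of "\<lambda>z. z > q", OF this(3)] show ?thesis .
      qed
      obtain C' where C': "countable C'"
        "\<And>a b. (a, b) \<in> C' \<Longrightarrow> a < b \<and> {a..b} \<subseteq> G' \<and> (f b - f a) / (b - a) > q"
        "disjoint_family_on (\<lambda>(a, b). {a..b}) C'"
        "negligible (E M \<inter> G' - (\<Union>(a, b)\<in>C'. {a..b}))"
        using Vitali_intervals[where P = "\<lambda>a b. (f b - f a) / (b - a) > q", OF G'o Int_lower2 cov2] by blast
      let ?J = "\<Union>(a, b)\<in>C'. {a..b}"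
      have J[measurable]: "?J \<in> sets borel" using C'(1) by (intro sets.countable_UN') auto
      \<comment> \<open>A point outside \<open>?J\<close> is missed by the first covering, is an
        endpoint dropped in \<open>G'\<close>, or is missed by the second covering.\<close>
      have "negligible (E M - ?J)"
      proof (rule negligible_subset)
        show "negligible ((E M - (\<Union>(a, b)\<in>C. {a..b})) \<union> (\<Union>(a, b)\<in>C. {a, b}) \<union> (E M \<inter> G' - ?J))"
        proof (intro negligible_Un C(4) C'(4))
          have "countable (\<Union>(a, b)\<in>C. {a, b})"
            using C(1) by auto
          then show "negligible (\<Union>(a, b)\<in>C. {a, b})"
            by (simp add: negligible_iff_null_sets countable_imp_null_set_lborel null_sets_completionI)
        qed
        show "E M - ?J \<subseteq> (E M - (\<Union>(a, b)\<in>C. {a..b})) \<union> (\<Union>(a, b)\<in>C. {a, b}) \<union> (E M \<inter> G' - ?J)"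
        proof
          fix x assume x: "x \<in> E M - ?J"
          show "x \<in> (E M - (\<Union>(a, b)\<in>C. {a..b})) \<union> (\<Union>(a, b)\<in>C. {a, b}) \<union> (E M \<inter> G' - ?J)"
          proof (cases "x \<in> G' \<or> x \<notin> (\<Union>(a, b)\<in>C. {a..b})")
            case True then show ?thesis using x by blast
          next
            case False
            then obtain a b where ab: "(a, b) \<in> C" "x \<in> {a..b}" "x \<notin> {a<..<b}" by (fastforce simp: G'_def)
            then have "x \<in> {a, b}" by auto
            with ab(1) show ?thesis by blast
          qed
        qed
      qed
      then have "E M - ?J \<in> null_sets lebesgue" by (simp add: negligible_iff_null_sets)
      then have n0: "emeasure lborel (E M - ?J) = 0" by (simp add: null_sets_def emeasure_completion)
      have "emeasure lborel (E M) \<le> emeasure lborel (?J \<union> (E M - ?J))"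
        by (intro emeasure_mono) auto
      also have "\<dots> \<le> emeasure lborel ?J + emeasure lborel (E M - ?J)"
        by (intro emeasure_subadditive) auto
      finally have "emeasure lborel (E M) \<le> emeasure lborel ?J" using n0 by simp
      then have "ennreal q * emeasure lborel (E M) \<le> ennreal q * emeasure lborel ?J"
        by (intro mult_left_mono) auto
      also have "emeasure lborel ?J = (\<integral>\<^sup>+ z. emeasure lborel (case z of (a, b) \<Rightarrow> {a..b}) \<partial>count_space C')"
        using C'(1,3) by (intro emeasure_UN_countable) auto
      also have "ennreal q * \<dots> = (\<integral>\<^sup>+ z. ennreal q * emeasure lborel (case z of (a, b) \<Rightarrow> {a..b}) \<partial>count_space C')"
        by (intro nn_integral_cmult[symmetric]) auto
      also have "\<dots> \<le> (\<integral>\<^sup>+ z. emeasure \<mu> (case z of (a, b) \<Rightarrow> {a..b}) \<partial>count_space C')"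
      proof (intro nn_integral_mono)
        fix z assume "z \<in> space (count_space C')"
        then obtain a b where z: "z = (a, b)" "(a, b) \<in> C'" by (cases z) auto
        with C'(2)[of a b] have ab: "a < b" "f b - f a \<ge> q * (b - a)" by (auto simp: field_simps)
        then show "ennreal q * emeasure lborel (case z of (a, b) \<Rightarrow> {a..b}) \<le> emeasure \<mu> (case z of (a, b) \<Rightarrow> {a..b})"
          using p pq z by (auto simp: icc ennreal_mult[symmetric] intro!: ennreal_leI)
      qed
      also have "\<dots> = emeasure \<mu> ?J"
        using C'(1,3) by (intro emeasure_UN_countable[symmetric]) auto
      also have "\<dots> \<le> emeasure \<mu> G'"
        using C'(2) G'o by (intro emeasure_mono) (auto intro: borel_open)
      finally show ?thesis using le1 by order
    qed
    obtain m where m: "emeasure lborel (E M) = ennreal m" "m \<ge> 0"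
      using fin by (cases "emeasure lborel (E M)") auto
    have "q * m \<le> p * m + e" if "e > 0" for e
    proof -
      \<comment> \<open>The error is \<open>e / p\<close> because \<open>main\<close> multiplies it
        by \<open>p\<close>.\<close>
      have "ennreal (q * m) \<le> ennreal (p * (m + e / p))"
        using main[of "e / p"] that p pq m by (simp add: ennreal_mult ennreal_plus[symmetric] del: ennreal_plus)
      then have "q * m \<le> p * (m + e / p)" using p m that by (simp add: ennreal_le_iff)
      also have "\<dots> = p * m + e" using p by (simp add: distrib_left)
      finally show ?thesis .
    qed
    then have "q * m \<le> p * m" by (rule field_le_epsilon)
    then have "m = 0" using pq m by (simp add: mult_le_cancel_right)
    then show ?thesis using m by simp
  qed
  have "osc_set f 1 p q = (\<Union>n::nat. E (real n))"
  proof -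
    have "\<exists>n::nat. - real n < x \<and> x < real n" for x
    proof -
      obtain n where "\<bar>x\<bar> < real n" using reals_Archimedean2 by blast
      then show ?thesis by (intro exI[of _ n]) auto
    qed
    then show ?thesis by (auto simp: E_def)
  qed
  moreover have "negligible (E M)" for M
  proof -
    have "E M \<in> null_sets lborel" using null by (auto simp: null_sets_def)
    then show ?thesis by (simp add: negligible_iff_null_sets null_sets_completionI)
  qed
  ultimately show ?thesis by (simp add: negligible_Union_nat)
qed

lemma osc_set_real_lipschitz_negligible:
  fixes f :: "real \<Rightarrow> real"
  assumes f: "K-lipschitz_on UNIV f" and pq: "p < q"
  shows "negligible (osc_set f 1 p q)"
proof -
  \<comment> \<open>Adding \<open>k * x\<close> shifts every difference quotient by
    \<open>k\<close>. The summand \<open>K\<close> makes the result monotone, and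
    \<open>\<bar>p\<bar> + 1\<close> lifts the lower slope \<open>p + k\<close> above 0.\<close>
  define k where "k = K + \<bar>p\<bar> + 1"
  have K: "K \<ge> 0" using f lipschitz_on_nonneg by blast
  let ?g = "\<lambda>x. f x + k * x"
  have cont: "continuous_on UNIV ?g"
    by (intro continuous_intros lipschitz_on_continuous_on[OF f])
  have mono: "mono ?g"
  proof (rule monoI)
    fix x y :: real assume "x \<le> y"
    then have "f x - f y \<le> K * (y - x)"
      using lipschitz_onD[OF f, of x y] by (auto simp: dist_real_def)
    also have "\<dots> \<le> k * (y - x)" using \<open>x \<le> y\<close> by (intro mult_right_mono) (auto simp: k_def)
    finally show "?g x \<le> ?g y" by (simp add: algebra_simps)
  qed
  have eq: "((f (x + h) + k * (x + h)) - (f x + k * x)) / h = (f (x + h) - f x) / h + k" if "h \<noteq> 0" for x h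
    using that by (simp add: field_simps)
  have "osc_set f 1 p q = osc_set ?g 1 (p + k) (q + k)"
    unfolding osc_set_def by (intro arg_cong2[where f = "(\<inter>)"] INF_cong SUP_cong refl) (simp_all add: eq)
  also have "negligible \<dots>"
    using pq K by (intro osc_set_real_negligible mono cont) (auto simp: k_def)
  finally show ?thesis .
qed

text \<open>Translation invariance replaces the decomposition of the space into parallel lines.\<close>

lemma null_sets_lborel_lines:
  fixes N :: "'a::euclidean_space set"
  assumes N: "N \<in> sets borel" and lines: "\<And>x. {t. x + t *\<^sub>R v \<in> N} \<in> null_sets lborel"
  shows "N \<in> null_sets lborel"
proof -
  have [measurable]: "N \<in> sets borel" by fact
  have "emeasure lborel N = (\<integral>\<^sup>+ x. indicator N x \<partial>lborel)" by simp
  \<comment> \<open>The factor \<open>indicator {0..1}\<close> has integral 1 and introduces the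
    line parameter \<open>t\<close>. A shift by \<open>t *\<^sub>R v\<close> leaves the inner
    integral unchanged, and Fubini then integrates along the lines first.\<close>
  also have "\<dots> = (\<integral>\<^sup>+ t. (\<integral>\<^sup>+ x. indicator N x \<partial>lborel) * indicator {0..1::real} t \<partial>lborel)"
    by (subst nn_integral_cmult) (auto simp: emeasure_lborel_Icc_eq)
  also have "\<dots> = (\<integral>\<^sup>+ t. (\<integral>\<^sup>+ x. indicator N (x + t *\<^sub>R v) * indicator {0..1::real} t \<partial>lborel) \<partial>lborel)"
  proof (intro nn_integral_cong)
    fix t :: real
    have "(\<integral>\<^sup>+ x. indicator N x \<partial>lborel) = (\<integral>\<^sup>+ x. indicator N x \<partial>distr lborel borel ((+) (t *\<^sub>R v)))"
      by (simp add: lborel_distr_plus)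
    also have "\<dots> = (\<integral>\<^sup>+ x. indicator N (x + t *\<^sub>R v) \<partial>lborel)"
      by (subst nn_integral_distr) (auto simp: add.commute)
    finally show "(\<integral>\<^sup>+ x. indicator N x \<partial>lborel) * indicator {0..1} t
      = (\<integral>\<^sup>+ x. indicator N (x + t *\<^sub>R v) * indicator {0..1} t \<partial>lborel)"
      by (subst nn_integral_multc) auto
  qed
  also have "\<dots> = (\<integral>\<^sup>+ x. (\<integral>\<^sup>+ t. indicator N (x + t *\<^sub>R v) * indicator {0..1::real} t \<partial>lborel) \<partial>lborel)"
    by (rule lborel_pair.Fubini') measurable
  also have "\<dots> = (\<integral>\<^sup>+ x. 0 \<partial>(lborel :: 'a measure))"
  proof (intro nn_integral_cong)
    fix x :: 'a
    have "(\<integral>\<^sup>+ t. indicator N (x + t *\<^sub>R v) * indicator {0..1::real} t \<partial>lborel) \<le> (\<integral>\<^sup>+ t. indicator {t. x + t *\<^sub>R v \<in> N} t \<partial>lborel)"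
      by (intro nn_integral_mono) (auto simp: indicator_def)
    also have "\<dots> = 0" using lines[of x] by (auto simp: null_sets_def)
    finally show "(\<integral>\<^sup>+ t. indicator N (x + t *\<^sub>R v) * indicator {0..1::real} t \<partial>lborel) = 0" by simp
  qed
  finally show ?thesis using N by (auto simp: null_sets_def)
qed

lemma osc_set_lipschitz_null:
  fixes f :: "'a::euclidean_space \<Rightarrow> real"
  assumes f: "K-lipschitz_on UNIV f" and pq: "p < q"
  shows "osc_set f v p q \<in> null_sets lborel"
proof (rule null_sets_lborel_lines)
  have cont: "continuous_on UNIV f" by (rule lipschitz_on_continuous_on[OF f])
  show "osc_set f v p q \<in> sets borel" by (rule sets_osc_set[OF cont])
  fix x
  let ?g = "\<lambda>t. f (x + t *\<^sub>R v)"
  have K: "K \<ge> 0" using f lipschitz_on_nonneg by blast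
  have g: "(K * norm v)-lipschitz_on UNIV ?g"
  proof (rule lipschitz_onI)
    fix s t :: real
    have "dist (?g s) (?g t) \<le> K * dist (x + s *\<^sub>R v) (x + t *\<^sub>R v)"
      by (intro lipschitz_onD[OF f]) auto
    also have "dist (x + s *\<^sub>R v) (x + t *\<^sub>R v) = norm v * dist s t"
      by (simp add: dist_norm flip: scaleR_left_diff_distrib)
    finally show "dist (?g s) (?g t) \<le> K * norm v * dist s t" by (simp add: mult.assoc)
  qed (use K in auto)
  have eq: "{t. x + t *\<^sub>R v \<in> osc_set f v p q} = osc_set ?g 1 p q"
    by (intro set_eqI) (simp add: osc_set_def scaleR_add_left add.assoc)
  have "osc_set ?g 1 p q \<in> sets borel"
    by (intro sets_osc_set lipschitz_on_continuous_on[OF g])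
  moreover have "negligible (osc_set ?g 1 p q)"
    by (rule osc_set_real_lipschitz_negligible[OF g pq])
  ultimately show "{t. x + t *\<^sub>R v \<in> osc_set f v p q} \<in> null_sets lborel"
    unfolding eq by (auto simp: negligible_iff_null_sets null_sets_def emeasure_completion)
qed

section \<open>Directional derivatives of Lipschitz functions\<close>

lemma lipschitz_quotient_bound:
  fixes f :: "'a::euclidean_space \<Rightarrow> real"
  assumes f: "K-lipschitz_on UNIV f"
  shows "\<bar>(f (x + h *\<^sub>R v) - f x) / h\<bar> \<le> K * norm v"
proof -
  have K: "K \<ge> 0" using f lipschitz_on_nonneg by blast
  have "\<bar>f (x + h *\<^sub>R v) - f x\<bar> \<le> K * (\<bar>h\<bar> * norm v)"
    using lipschitz_onD[OF f, of "x + h *\<^sub>R v" x] by (simp add: dist_norm)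
  then show ?thesis using K by (cases "h = 0") (auto simp: field_simps abs_divide)
qed

lemma AE_directional_derivative:
  fixes f :: "'a::euclidean_space \<Rightarrow> real"
  assumes f: "K-lipschitz_on UNIV f"
  shows "AE x in lborel. \<exists>D. ((\<lambda>h. (f (x + h *\<^sub>R v) - f x) / h) \<longlongrightarrow> D) (at 0)"
proof -
  have "AE x in lborel. \<forall>p\<in>\<rat>. \<forall>q\<in>\<rat>. p < q \<longrightarrow> x \<notin> osc_set f v p q"
    using osc_set_lipschitz_null[OF f]
    by (intro AE_ball_countable[THEN iffD2] countable_rat ballI) (auto intro!: AE_not_in)
  then show ?thesis
  proof eventually_elim
    case (elim x)
    let ?Q = "\<lambda>h. (f (x + h *\<^sub>R v) - f x) / h"
    show ?case
    proof (rule bounded_tendsto_or_oscillates[of ?Q "K * norm v"])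
      show "\<bar>?Q h\<bar> \<le> K * norm v" for h by (rule lipschitz_quotient_bound[OF f])
      fix p q :: real assume pq: "p \<in> \<rat>" "q \<in> \<rat>" "p < q"
      show "\<not> ((\<exists>\<^sub>F h in at 0. ?Q h < p) \<and> (\<exists>\<^sub>F h in at 0. ?Q h > q))"
      proof
        assume A: "(\<exists>\<^sub>F h in at 0. ?Q h < p) \<and> (\<exists>\<^sub>F h in at 0. ?Q h > q)"
        have ev: "\<forall>\<^sub>F h in at 0. h \<noteq> 0 \<and> \<bar>h\<bar> < 1 / Suc n" for n
          by (auto simp: eventually_at intro!: exI[of _ "1 / Suc n"])
        have "x \<in> osc_set f v p q"
          unfolding osc_set_def
        proof (intro IntI INT_I)
          fix n
          have "\<exists>\<^sub>F h in at 0. ?Q h < p \<and> h \<noteq> 0 \<and> \<bar>h\<bar> < 1 / Suc n"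
            using frequently_eventually_frequently[OF conjunct1[OF A] ev] .
          from frequently_ex[OF this]
          show "x \<in> (\<Union>h\<in>{h. h \<noteq> 0 \<and> \<bar>h\<bar> < 1 / Suc n}. {x. (f (x + h *\<^sub>R v) - f x) / h < p})" by blast
          have "\<exists>\<^sub>F h in at 0. ?Q h > q \<and> h \<noteq> 0 \<and> \<bar>h\<bar> < 1 / Suc n"
            using frequently_eventually_frequently[OF conjunct2[OF A] ev] .
          from frequently_ex[OF this]
          show "x \<in> (\<Union>h\<in>{h. h \<noteq> 0 \<and> \<bar>h\<bar> < 1 / Suc n}. {x. (f (x + h *\<^sub>R v) - f x) / h > q})" by blast
        qed
        with elim pq show False by blast
      qed
    qed blast
  qed
qed

text \<open>A limit along one sequence is Borel measurable in \<open>x\<close>. Where the sequence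
  diverges, \<open>lim\<close> is unspecified; for Lipschitz \<open>f\<close> the full directional
  limit exists almost everywhere and agrees with it.\<close>

definition dir_deriv :: "('a::real_normed_vector \<Rightarrow> real) \<Rightarrow> 'a \<Rightarrow> 'a \<Rightarrow> real" where
  "dir_deriv f v x = lim (\<lambda>n. (f (x + (1 / Suc n) *\<^sub>R v) - f x) / (1 / Suc n))"

lemma dir_deriv_eqI:
  assumes "((\<lambda>h. (f (x + h *\<^sub>R v) - f x) / h) \<longlongrightarrow> D) (at 0)"
  shows "(\<lambda>n. (f (x + (1 / Suc n) *\<^sub>R v) - f x) / (1 / Suc n)) \<longlonglongrightarrow> D" "dir_deriv f v x = D"
proof -
  have "filterlim (\<lambda>n. 1 / real (Suc n)) (at 0) sequentially"
    using LIMSEQ_inverse_real_of_nat by (intro filterlim_atI) (auto simp: inverse_eq_divide)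
  from filterlim_compose[OF assms this]
  show "(\<lambda>n. (f (x + (1 / Suc n) *\<^sub>R v) - f x) / (1 / Suc n)) \<longlonglongrightarrow> D" by simp
  then show "dir_deriv f v x = D" unfolding dir_deriv_def by (rule limI)
qed

lemma AE_dir_deriv:
  fixes f :: "'a::euclidean_space \<Rightarrow> real"
  assumes f: "K-lipschitz_on UNIV f"
  shows "AE x in lborel. ((\<lambda>h. (f (x + h *\<^sub>R v) - f x) / h) \<longlongrightarrow> dir_deriv f v x) (at 0)"
  using AE_directional_derivative[OF f, of v] by eventually_elim (auto dest: dir_deriv_eqI(2))

lemma measurable_dir_deriv:
  fixes f :: "'a::euclidean_space \<Rightarrow> real"
  assumes f: "K-lipschitz_on UNIV f"
  shows "dir_deriv f v \<in> borel_measurable borel"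
proof -
  have [measurable]: "f \<in> borel_measurable borel"
    by (intro borel_measurable_continuous_onI lipschitz_on_continuous_on[OF f])
  show ?thesis unfolding dir_deriv_def[abs_def] by measurable
qed

lemma AE_dir_deriv_bound:
  fixes f :: "'a::euclidean_space \<Rightarrow> real"
  assumes f: "K-lipschitz_on UNIV f"
  shows "AE x in lborel. \<bar>dir_deriv f v x\<bar> \<le> K * norm v"
  using AE_dir_deriv[OF f, of v]
proof eventually_elim
  case (elim x)
  show ?case
    using tendsto_rabs[OF elim] lipschitz_quotient_bound[OF f]
    by (intro tendsto_upperbound[of _ _ "at (0::real)"]) (auto intro!: always_eventually)
qed

section \<open>Test integrals over boxes\<close>

lemma integrable_indicator_mult:
  fixes g :: "'a::euclidean_space \<Rightarrow> real"
  assumes [measurable]: "B \<in> sets borel" "g \<in> borel_measurable borel" and "bounded B"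
    and g: "AE x in lborel. x \<in> B \<longrightarrow> \<bar>g x\<bar> \<le> C"
  shows "integrable lborel (\<lambda>x. indicator B x * g x)"
proof (rule Bochner_Integration.integrable_bound)
  show "integrable lborel (\<lambda>x. C * indicator B x :: real)"
    using emeasure_bounded_finite[OF \<open>bounded B\<close>]
    by (intro integrable_mult_right integrable_real_indicator) simp_all
  show "AE x in lborel. norm (indicator B x * g x) \<le> norm (C * indicator B x :: real)"
    using g by eventually_elim (auto simp: indicator_def)
qed measurable

text \<open>The density \<open>1 + g / k\<close> gives every box its volume, so it defines Lebesgue
  measure again, and uniqueness of densities yields \<open>g = 0\<close>. The constant
  \<open>k\<close> exceeds \<open>\<bar>C\<bar>\<close> to keep the density nonnegative.\<close>

lemma AE_eq_0_if_integral_box_eq_0: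
  fixes g :: "'a::euclidean_space \<Rightarrow> real"
  assumes [measurable]: "g \<in> borel_measurable borel" and bound: "AE x in lborel. \<bar>g x\<bar> \<le> C"
    and zero: "\<And>a b. (LINT x|lborel. indicator (box a b) x * g x) = 0"
  shows "AE x in lborel. g x = 0"
proof -
  define k where "k = \<bar>C\<bar> + 1"
  have k: "k > 0" by (simp add: k_def)
  have bound': "AE x in lborel. 0 \<le> 1 + g x / k"
    using bound by eventually_elim (use k in \<open>auto simp: k_def field_simps\<close>)
  let ?D = "density lborel (\<lambda>x. ennreal (1 + g x / k))"
  have "lborel = ?D"
  proof (rule lborel_eqI)
    fix l u :: 'a assume lu: "\<And>b. b \<in> Basis \<Longrightarrow> l \<bullet> b \<le> u \<bullet> b"
    have i1: "integrable lborel (\<lambda>x. indicator (box l u) x :: real)"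
      using emeasure_lborel_box_finite[of l u] by (intro integrable_real_indicator) simp_all
    have i2: "integrable lborel (\<lambda>x. indicator (box l u) x * g x)"
      by (rule integrable_indicator_mult[where C = C]) (use bound in auto)
    have "emeasure ?D (box l u) = (\<integral>\<^sup>+x. ennreal (1 + g x / k) * indicator (box l u) x \<partial>lborel)"
      by (subst emeasure_density) auto
    also have "\<dots> = (\<integral>\<^sup>+x. ennreal (indicator (box l u) x + (indicator (box l u) x * g x) / k) \<partial>lborel)"
      by (intro nn_integral_cong) (auto simp: indicator_def)
    also have "\<dots> = ennreal (LINT x|lborel. indicator (box l u) x + (indicator (box l u) x * g x) / k)"
      using bound' by (intro nn_integral_eq_integral Bochner_Integration.integrable_add i1 integrable_divide i2)
        (auto simp: indicator_def)
    also have "(LINT x|lborel. indicator (box l u) x + (indicator (box l u) x * g x) / k) = measure lborel (box l u)"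
      by (subst Bochner_Integration.integral_add) (use i1 i2 zero in auto)
    also have "ennreal (measure lborel (box l u)) = emeasure lborel (box l u)"
      using emeasure_lborel_box_finite[of l u] by (intro emeasure_eq_ennreal_measure[symmetric]) auto
    finally show "emeasure ?D (box l u) = (\<Prod>b\<in>Basis. (u - l) \<bullet> b)"
      using lu by simp
  qed simp
  then have "density lborel (\<lambda>x. 1) = ?D" by (simp add: density_1)
  then have "AE x in lborel. 1 = ennreal (1 + g x / k)"
    by (subst (asm) sigma_finite_measure.density_unique_iff[OF sigma_finite_lborel]) auto
  with bound' show ?thesis
  proof eventually_elim
    case (elim x)
    then have "1 + g x / k = 1" by (metis ennreal_1 ennreal_inj zero_le_one)
    then show ?case using k by simp
  qed
qed

section \<open>Rademacher's theorem\<close>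

text \<open>Dominated convergence. The box drifts by \<open>(1 / Suc n) *\<^sub>R u\<close> because
  the change of variables in \<open>AE_dir_deriv_add\<close> produces such a shift; the shifted
  indicators converge off the boundary of the box, which is null.\<close>

lemma tendsto_integral_box_dir_deriv:
  fixes f :: "'a::euclidean_space \<Rightarrow> real"
  assumes f: "K-lipschitz_on UNIV f"
  shows "(\<lambda>n. LINT x|lborel. indicator (box a b) (x - (1 / Suc n) *\<^sub>R u) *
            ((f (x + (1 / Suc n) *\<^sub>R v) - f x) / (1 / Suc n)))
    \<longlonglongrightarrow> (LINT x|lborel. indicator (box a b) x * dir_deriv f v x)"
proof -
  have [measurable]: "f \<in> borel_measurable borel" "dir_deriv f v \<in> borel_measurable borel"
    by (intro borel_measurable_continuous_onI lipschitz_on_continuous_on[OF f])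
       (rule measurable_dir_deriv[OF f])
  have K: "K \<ge> 0" using f lipschitz_on_nonneg by blast
  obtain r where r: "box a b \<subseteq> cball 0 r"
    proof -
    obtain r where "\<forall>y\<in>box a b. dist 0 y \<le> r"
      using bounded_box[of a b] bounded_any_center by blast
    then show thesis by (intro that[of r]) auto
  qed
  \<comment> \<open>The ball of radius \<open>R\<close> contains all shifted boxes, since each shift
    has length at most \<open>norm u\<close>.\<close>
  define R where "R = r + norm u"
  have c: "(\<lambda>n. x - (1 / Suc n) *\<^sub>R u) \<longlonglongrightarrow> x" for x
  proof -
    have "(\<lambda>n. x - (1 / Suc n) *\<^sub>R u) \<longlonglongrightarrow> x - 0 *\<^sub>R u"
      using LIMSEQ_inverse_real_of_nat by (intro tendsto_intros) (simp add: inverse_eq_divide)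
    then show ?thesis by simp
  qed
  show ?thesis
  proof (rule integral_dominated_convergence[where w = "\<lambda>x. K * norm v * indicator (cball 0 R) x"])
    show "integrable lborel (\<lambda>x. K * norm v * indicator (cball (0::'a) R) x)"
      using emeasure_bounded_finite[of "cball (0::'a) R"]
      by (intro integrable_mult_right integrable_real_indicator) simp_all
    have "cbox a b - box a b \<in> null_sets lborel"
      using negligible_frontier_interval[of a b]
      by (auto simp: negligible_iff_null_sets null_sets_def emeasure_completion)
    then have "AE x in lborel. x \<notin> cbox a b - box a b" by (rule AE_not_in)
    with AE_dir_deriv[OF f, of v]
    show "AE x in lborel. (\<lambda>n. indicator (box a b) (x - (1 / Suc n) *\<^sub>R u) *
            ((f (x + (1 / Suc n) *\<^sub>R v) - f x) / (1 / Suc n)))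
      \<longlonglongrightarrow> indicator (box a b) x * dir_deriv f v x"
    proof eventually_elim
      case (elim x)
      have "(\<lambda>n. indicator (box a b) (x - (1 / Suc n) *\<^sub>R u) :: real) \<longlonglongrightarrow> indicator (box a b) x"
      proof (cases "x \<in> box a b")
        case True
        have "\<forall>\<^sub>F n in sequentially. x - (1 / Suc n) *\<^sub>R u \<in> box a b"
          using topological_tendstoD[OF c open_box True] .
        then show ?thesis
          by (intro tendsto_eventually) (auto elim!: eventually_mono simp: True)
      next
        case False
        with elim have x: "x \<in> - cbox a b" by auto
        have "\<forall>\<^sub>F n in sequentially. x - (1 / Suc n) *\<^sub>R u \<in> - cbox a b"
          by (rule topological_tendstoD[OF c _ x]) (simp add: closed_cbox open_Compl)
        then show ?thesis
          using False box_subset_cbox[of a b]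
          by (intro tendsto_eventually) (auto elim!: eventually_mono simp: indicator_def)
      qed
      with dir_deriv_eqI(1)[OF elim(1)] show ?case by (intro tendsto_mult)
    qed
    fix n
    show "AE x in lborel. norm (indicator (box a b) (x - (1 / Suc n) *\<^sub>R u) *
            ((f (x + (1 / Suc n) *\<^sub>R v) - f x) / (1 / Suc n))) \<le> K * norm v * indicator (cball 0 R) x"
    proof (intro AE_I2)
      fix x
      let ?y = "x - (1 / Suc n) *\<^sub>R u"
      show "norm (indicator (box a b) ?y *
            ((f (x + (1 / Suc n) *\<^sub>R v) - f x) / (1 / Suc n))) \<le> K * norm v * indicator (cball 0 R) x"
      proof (cases "?y \<in> box a b")
        case True
        then have "norm ?y \<le> r" using r by auto
        moreover have "norm ((1 / Suc n) *\<^sub>R u) \<le> norm u"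
          by (simp add: field_simps mult_left_le)
        moreover have "norm x \<le> norm ?y + norm ((1 / Suc n) *\<^sub>R u)"
          by (metis diff_add_cancel norm_triangle_ineq)
        ultimately have "x \<in> cball 0 R" by (simp add: R_def)
        then show ?thesis using True lipschitz_quotient_bound[OF f, of x "1 / Suc n" v] by simp
      qed (use K in simp)
    qed
  qed measurable
qed

text \<open>The quotient along \<open>u + v\<close> is the quotient along \<open>u\<close> plus a translate of the one along \<open>v\<close>;
  integrals over boxes do not see the translation in the limit.\<close>

lemma AE_dir_deriv_add:
  fixes f :: "'a::euclidean_space \<Rightarrow> real"
  assumes f: "K-lipschitz_on UNIV f"
  shows "AE x in lborel. dir_deriv f (u + v) x = dir_deriv f u x + dir_deriv f v x"
proof -
  have [measurable]: "f \<in> borel_measurable borel" "dir_deriv f v \<in> borel_measurable borel" for v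
    by (intro borel_measurable_continuous_onI lipschitz_on_continuous_on[OF f])
       (rule measurable_dir_deriv[OF f])
  have K: "K \<ge> 0" using f lipschitz_on_nonneg by blast
  have int: "integrable lborel (\<lambda>x. indicator (box a b) x * g x)"
    if "g \<in> borel_measurable borel" and g: "AE x in lborel. \<bar>g x\<bar> \<le> C" for a b :: 'a and g :: "'a \<Rightarrow> real" and C
    using that by (intro integrable_indicator_mult[where C = C]) auto
  have int_dd: "integrable lborel (\<lambda>x. indicator (box a b) x * dir_deriv f w x)" for a b w
    by (rule int[OF _ AE_dir_deriv_bound[OF f]]) measurable
  have "AE x in lborel. dir_deriv f (u + v) x - (dir_deriv f u x + dir_deriv f v x) = 0"
  proof (rule AE_eq_0_if_integral_box_eq_0)
    show "AE x in lborel. \<bar>dir_deriv f (u + v) x - (dir_deriv f u x + dir_deriv f v x)\<bar>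
        \<le> K * norm (u + v) + K * norm u + K * norm v"
      using AE_dir_deriv_bound[OF f, of u] AE_dir_deriv_bound[OF f, of v] AE_dir_deriv_bound[OF f, of "u + v"]
      by eventually_elim auto
    fix a b :: 'a
    let ?i = "indicator (box a b) :: 'a \<Rightarrow> real"
    let ?D = "\<lambda>n w x. (f (x + (1 / Suc n) *\<^sub>R w) - f x) / (1 / Suc n)"
    \<comment> \<open>The shift by 0 only brings the unshifted integrals into the form of
      \<open>tendsto_integral_box_dir_deriv\<close>.\<close>
    have 1: "(LINT x|lborel. ?i (x - (1 / Suc n) *\<^sub>R 0) * ?D n (u + v) x)
      = (LINT x|lborel. ?i (x - (1 / Suc n) *\<^sub>R 0) * ?D n u x) + (LINT x|lborel. ?i (x - (1 / Suc n) *\<^sub>R u) * ?D n v x)" for n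
    proof -
      let ?c = "(1 / Suc n) *\<^sub>R u"
      have "(LINT x|lborel. ?i (x - ?c) * ?D n v x) = (LINT x|distr lborel borel ((+) ?c). ?i (x - ?c) * ?D n v x)"
        by (simp add: lborel_distr_plus)
      also have "\<dots> = (LINT x|lborel. ?i x * ?D n v (?c + x))"
        by (subst integral_distr) simp_all
      finally have 2: "(LINT x|lborel. ?i (x - ?c) * ?D n v x) = (LINT x|lborel. ?i x * ?D n v (?c + x))" .
      have "integrable lborel (\<lambda>x. ?i x * ?D n u x)" "integrable lborel (\<lambda>x. ?i x * ?D n v (?c + x))"
        by (rule int[OF _ AE_I2[OF lipschitz_quotient_bound[OF f]]], measurable)+
      from Bochner_Integration.integral_add[OF this]
      have "(LINT x|lborel. ?i x * ?D n u x) + (LINT x|lborel. ?i x * ?D n v (?c + x))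
        = (LINT x|lborel. ?i x * ?D n u x + ?i x * ?D n v (?c + x))" by simp
      also have "\<dots> = (LINT x|lborel. ?i x * ?D n (u + v) x)"
      proof (rule Bochner_Integration.integral_cong[OF refl])
        fix x
        have eq: "x + (1 / Suc n) *\<^sub>R (u + v) = ?c + x + (1 / Suc n) *\<^sub>R v"
          by (simp add: scaleR_add_right)
        have "(p - q) / h + (r - p) / h = (r - q) / h" for p q r h :: real
          by (simp add: diff_divide_distrib)
        then have "?D n u x + ?D n v (?c + x) = ?D n (u + v) x"
          unfolding eq add.commute[of x ?c] .
        then show "?i x * ?D n u x + ?i x * ?D n v (?c + x) = ?i x * ?D n (u + v) x"
          by (metis distrib_left)
      qed
      finally show ?thesis unfolding 2 by simp
    qed
    have "(\<lambda>n. LINT x|lborel. ?i (x - (1 / Suc n) *\<^sub>R 0) * ?D n (u + v) x)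
      \<longlonglongrightarrow> (LINT x|lborel. ?i x * dir_deriv f u x) + (LINT x|lborel. ?i x * dir_deriv f v x)"
      unfolding 1 by (intro tendsto_add tendsto_integral_box_dir_deriv[OF f])
    from LIMSEQ_unique[OF this tendsto_integral_box_dir_deriv[OF f]]
    have "(LINT x|lborel. ?i x * dir_deriv f u x) + (LINT x|lborel. ?i x * dir_deriv f v x)
      = (LINT x|lborel. ?i x * dir_deriv f (u + v) x)" .
    then show "(LINT x|lborel. ?i x * (dir_deriv f (u + v) x - (dir_deriv f u x + dir_deriv f v x))) = 0"
      by (simp add: right_diff_distrib distrib_left int_dd)
  qed measurable
  then show ?thesis by simp
qed

lemma AE_dir_deriv_scaleR:
  fixes f :: "'a::euclidean_space \<Rightarrow> real"
  assumes f: "K-lipschitz_on UNIV f"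
  shows "AE x in lborel. dir_deriv f (c *\<^sub>R v) x = c * dir_deriv f v x"
  using AE_dir_deriv[OF f, of v]
proof eventually_elim
  case (elim x)
  show ?case
  proof (cases "c = 0")
    case True
    then show ?thesis by (intro dir_deriv_eqI(2)) simp
  next
    case False
    have "((\<lambda>h::real. c * h) \<longlongrightarrow> c * 0) (at 0)" by (intro tendsto_intros)
    then have "filterlim (\<lambda>h. c * h) (at 0) (at 0)"
      using False by (intro filterlim_atI) (auto simp: eventually_at intro!: exI[of _ 1])
    from filterlim_compose[OF elim this]
    have "((\<lambda>h. c * ((f (x + (c * h) *\<^sub>R v) - f x) / (c * h))) \<longlongrightarrow> c * dir_deriv f v x) (at 0)"
      by (rule tendsto_mult_left)
    then have "((\<lambda>h. (f (x + h *\<^sub>R (c *\<^sub>R v)) - f x) / h) \<longlongrightarrow> c * dir_deriv f v x) (at 0)"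
      using False by (simp add: mult.commute)
    then show ?thesis by (rule dir_deriv_eqI(2))
  qed
qed

lemma AE_dir_deriv_sum:
  fixes f :: "'a::euclidean_space \<Rightarrow> real"
  assumes f: "K-lipschitz_on UNIV f" and "finite B"
  shows "AE x in lborel. dir_deriv f (\<Sum>b\<in>B. c b *\<^sub>R b) x = (\<Sum>b\<in>B. c b * dir_deriv f b x)"
  using assms(2)
proof (induction B)
  case empty
  show ?case using AE_dir_deriv_scaleR[OF f, of 0 0] by simp
next
  case (insert b B)
  show ?case
    using insert.IH AE_dir_deriv_add[OF f, of "c b *\<^sub>R b" "\<Sum>b\<in>B. c b *\<^sub>R b"] AE_dir_deriv_scaleR[OF f, of "c b" b]
    by eventually_elim (use insert.hyps in simp)
qed

text \<open>Compactness of the sphere makes the convergence uniform: finitely many directions of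
  \<open>D\<close> come within \<open>r\<close> of every unit vector. Replacing a direction by such
  a neighbour costs at most \<open>(K + norm g) * r\<close> relative to the step length, and
  \<open>r\<close> is chosen to keep this below \<open>e / 2\<close>.\<close>

lemma has_derivative_if_dense_directions:
  fixes f :: "'a::euclidean_space \<Rightarrow> real"
  assumes f: "K-lipschitz_on UNIV f"
    and dense: "\<And>X. open X \<Longrightarrow> X \<noteq> {} \<Longrightarrow> \<exists>v\<in>D. v \<in> X"
    and lim: "\<And>v. v \<in> D \<Longrightarrow> ((\<lambda>h. (f (x + h *\<^sub>R v) - f x) / h) \<longlongrightarrow> v \<bullet> g) (at 0)"
  shows "(f has_derivative (\<lambda>h. h \<bullet> g)) (at x)"
  unfolding has_derivative_at_alt
proof (intro conjI allI impI)
  show "bounded_linear (\<lambda>h. h \<bullet> g)" by (rule bounded_linear_inner_left)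
  fix e :: real assume e: "0 < e"
  have K: "K \<ge> 0" using f lipschitz_on_nonneg by blast
  define M where "M = K + norm g + 1"
  have M: "M > 0" using K by (simp add: M_def add_nonneg_pos)
  define r where "r = e / (2 * M)"
  have r: "r > 0" using e M by (simp add: r_def)
  have "sphere 0 1 \<subseteq> (\<Union>v\<in>D. ball v r)"
  proof
    fix u :: 'a
    obtain v where "v \<in> D" "v \<in> ball u r" using dense[of "ball u r"] r by auto
    then show "u \<in> (\<Union>v\<in>D. ball v r)" by (auto simp: dist_commute)
  qed
  with compactE_image[OF compact_sphere, of D "\<lambda>v. ball v r" "0 :: 'a" 1] obtain F where
    F: "F \<subseteq> D" "finite F" "sphere 0 1 \<subseteq> (\<Union>v\<in>F. ball v r)"
    by (metis open_ball)
  have "\<forall>\<^sub>F h in at 0. \<forall>v\<in>F. \<bar>(f (x + h *\<^sub>R v) - f x) / h - v \<bullet> g\<bar> < e / 2"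
  proof (intro eventually_ball_finite F(2) ballI)
    fix v assume "v \<in> F"
    then have "v \<in> D" using F(1) by auto
    from tendstoD[OF lim[OF this], of "e / 2"] e
    show "\<forall>\<^sub>F h in at 0. \<bar>(f (x + h *\<^sub>R v) - f x) / h - v \<bullet> g\<bar> < e / 2"
      by (simp add: dist_real_def)
  qed
  then obtain d where d: "d > 0"
    "\<And>h v. h \<noteq> 0 \<Longrightarrow> \<bar>h\<bar> < d \<Longrightarrow> v \<in> F \<Longrightarrow> \<bar>(f (x + h *\<^sub>R v) - f x) / h - v \<bullet> g\<bar> < e / 2"
    unfolding eventually_at by auto
  show "\<exists>d>0. \<forall>y. norm (y - x) < d \<longrightarrow> norm (f y - f x - (y - x) \<bullet> g) \<le> e * norm (y - x)"
  proof (intro exI[of _ d] conjI allI impI d(1))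
    fix y assume y: "norm (y - x) < d"
    show "norm (f y - f x - (y - x) \<bullet> g) \<le> e * norm (y - x)"
    proof (cases "y = x")
      case False
      define t where "t = norm (y - x)"
      define u where "u = (y - x) /\<^sub>R t"
      have t: "t > 0" "t < d" using False y by (auto simp: t_def)
      have yu: "y = x + t *\<^sub>R u" using t by (simp add: u_def)
      have "norm u = 1" using t by (simp add: u_def t_def)
      then obtain v where v: "v \<in> F" "dist v u < r" using F(3) by force
      have "\<bar>(f (x + t *\<^sub>R v) - f x) / t - v \<bullet> g\<bar> < e / 2" using d(2)[of t v] t v by simp
      moreover have "(f (x + t *\<^sub>R v) - f x) / t - v \<bullet> g = (f (x + t *\<^sub>R v) - f x - t * (v \<bullet> g)) / t"
        using t by (simp add: field_simps)
      ultimately have 1: "\<bar>f (x + t *\<^sub>R v) - f x - t * (v \<bullet> g)\<bar> \<le> e / 2 * t"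
        using t by (simp add: abs_divide field_simps)
      have "\<bar>f y - f (x + t *\<^sub>R v)\<bar> \<le> K * (t * dist v u)"
        using lipschitz_onD[OF f, of y "x + t *\<^sub>R v"] t unfolding yu
        by (simp add: dist_norm norm_minus_commute flip: scaleR_diff_right)
      moreover have "\<bar>(v - u) \<bullet> g\<bar> \<le> dist v u * norm g"
        by (simp add: dist_norm Cauchy_Schwarz_ineq2)
      then have "t * \<bar>(v - u) \<bullet> g\<bar> \<le> t * (dist v u * norm g)"
        using t by (intro mult_left_mono) auto
      then have "\<bar>t * ((v - u) \<bullet> g)\<bar> \<le> t * (dist v u * norm g)"
        using t by (simp add: abs_mult)
      moreover have "f y - f x - (y - x) \<bullet> g
          = (f (x + t *\<^sub>R v) - f x - t * (v \<bullet> g)) + (f y - f (x + t *\<^sub>R v)) + t * ((v - u) \<bullet> g)"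
        by (simp add: yu inner_diff_left algebra_simps)
      ultimately have "\<bar>f y - f x - (y - x) \<bullet> g\<bar> \<le> e / 2 * t + K * (t * dist v u) + t * (dist v u * norm g)"
        using 1 by linarith
      also have "\<dots> = e / 2 * t + (K + norm g) * dist v u * t"
        by (simp add: algebra_simps)
      also have "(K + norm g) * dist v u * t \<le> M * r * t"
        using t v(2) K r M by (intro mult_mono) (auto simp: M_def)
      also have "M * r = e / 2" using M by (simp add: r_def)
      finally show ?thesis by (simp add: t_def)
    qed simp
  qed
qed

text \<open>Existence and linearity of the directional derivatives fail on null sets that depend on
  the direction. A countable dense set of directions shares one null set, and the Lipschitz bound
  takes care of all other directions.\<close>

theorem Rademacher:
  fixes f :: "'a::euclidean_space \<Rightarrow> real"
  assumes f: "K-lipschitz_on UNIV f"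
  obtains g where "g \<in> borel_measurable borel"
    "AE x in lborel. (f has_derivative (\<lambda>h. h \<bullet> g x)) (at x)"
proof
  define g where "g x = (\<Sum>b\<in>Basis. dir_deriv f b x *\<^sub>R b)" for x
  have [measurable]: "dir_deriv f v \<in> borel_measurable borel" for v
    by (rule measurable_dir_deriv[OF f])
  show "g \<in> borel_measurable borel" unfolding g_def[abs_def] by measurable
  obtain D :: "'a set" where D: "countable D" "\<And>X. open X \<Longrightarrow> X \<noteq> {} \<Longrightarrow> \<exists>v\<in>D. v \<in> X"
    using countable_dense_setE by blast
  have "AE x in lborel. ((\<lambda>h. (f (x + h *\<^sub>R v) - f x) / h) \<longlongrightarrow> v \<bullet> g x) (at 0)" for v
    using AE_dir_deriv[OF f, of v] AE_dir_deriv_sum[OF f finite_Basis, of "\<lambda>b. v \<bullet> b"]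
  proof eventually_elim
    case (elim x)
    have "v \<bullet> g x = (\<Sum>b\<in>Basis. (v \<bullet> b) * dir_deriv f b x)"
      unfolding g_def inner_sum_right by (intro sum.cong) auto
    then show ?case using elim by (simp add: euclidean_representation)
  qed
  then have "AE x in lborel. \<forall>v\<in>D. ((\<lambda>h. (f (x + h *\<^sub>R v) - f x) / h) \<longlongrightarrow> v \<bullet> g x) (at 0)"
    using D(1) by (simp add: AE_ball_countable)
  then show "AE x in lborel. (f has_derivative (\<lambda>h. h \<bullet> g x)) (at x)"
    by eventually_elim (rule has_derivative_if_dense_directions[OF f D(2)], auto)
qed

section \<open>Subsolutions above a plane\<close>

text \<open>For an \<open>L\<close>-Lipschitz \<open>b\<close>, only pairs are constrained for which
  \<open>b\<close> is forced to be positive on the whole segment. The product form contains no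
  division and passes to limits.\<close>

definition admissible :: "real \<Rightarrow> ('a::euclidean_space \<Rightarrow> real) \<Rightarrow> real \<Rightarrow> ('a \<Rightarrow> real) \<Rightarrow> bool" where
  "admissible L b c u \<longleftrightarrow>
    (\<forall>x y. L * dist x y < b x \<longrightarrow> (b x - L * dist x y) * \<bar>u y - u x\<bar> \<le> c * dist x y)"

definition above_plane :: "'a::euclidean_space \<Rightarrow> ('a \<Rightarrow> real) \<Rightarrow> bool" where
  "above_plane p u \<longleftrightarrow> (\<forall>e>0. \<exists>R. \<forall>y. R \<le> norm y \<longrightarrow> - e * norm y \<le> u y - p \<bullet> y)"

text \<open>The Lipschitz constant is existential: admissibility gives no control where
  \<open>b\<close> vanishes, so growth there is bounded separately.\<close>

definition attains :: "real \<Rightarrow> ('a::euclidean_space \<Rightarrow> real) \<Rightarrow> 'a \<Rightarrow> real \<Rightarrow> bool" where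
  "attains L b p c \<longleftrightarrow> (\<exists>u K. K-lipschitz_on UNIV u \<and> admissible L b c u \<and> above_plane p u)"

definition ham :: "real \<Rightarrow> ('a::euclidean_space \<Rightarrow> real) \<Rightarrow> 'a \<Rightarrow> real" where
  "ham L b p = Inf {c. attains L b p c}"

lemma above_plane_add:
  assumes "above_plane p u" "above_plane q v"
  shows "above_plane (p + q) (\<lambda>y. u y + v y)"
  unfolding above_plane_def
proof (intro allI impI)
  fix e :: real assume e: "e > 0"
  obtain R where R: "\<And>y. R \<le> norm y \<Longrightarrow> - (e / 2) * norm y \<le> u y - p \<bullet> y"
    using assms(1) e unfolding above_plane_def by (meson half_gt_zero)
  obtain S where S: "\<And>y. S \<le> norm y \<Longrightarrow> - (e / 2) * norm y \<le> v y - q \<bullet> y"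
    using assms(2) e unfolding above_plane_def by (meson half_gt_zero)
  have "- e * norm y \<le> u y + v y - (p + q) \<bullet> y" if "max R S \<le> norm y" for y
    using R[of y] S[of y] that by (simp add: inner_add_left)
  then show "\<exists>R. \<forall>y. R \<le> norm y \<longrightarrow> - e * norm y \<le> u y + v y - (p + q) \<bullet> y" by blast
qed

lemma above_plane_scaleR:
  assumes "above_plane p u" "r > 0"
  shows "above_plane (r *\<^sub>R p) (\<lambda>y. r * u y)"
  unfolding above_plane_def
proof (intro allI impI)
  fix e :: real assume e: "e > 0"
  then have "e / r > 0" using assms(2) by simp
  then obtain R where R: "\<And>y. R \<le> norm y \<Longrightarrow> - (e / r) * norm y \<le> u y - p \<bullet> y"
    using assms(1) unfolding above_plane_def by meson
  have "- e * norm y \<le> r * u y - (r *\<^sub>R p) \<bullet> y" if "R \<le> norm y" for y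
  proof -
    have "r * (- (e / r) * norm y) \<le> r * (u y - p \<bullet> y)"
      using R[OF that] assms(2) by (intro mult_left_mono) auto
    then show ?thesis using assms(2) by (simp add: right_diff_distrib)
  qed
  then show "\<exists>R. \<forall>y. R \<le> norm y \<longrightarrow> - e * norm y \<le> r * u y - (r *\<^sub>R p) \<bullet> y" by blast
qed

lemma attains_add:
  assumes "attains L b p c" "attains L b q d"
  shows "attains L b (p + q) (c + d)"
proof -
  obtain u K where u: "K-lipschitz_on UNIV u" "admissible L b c u" "above_plane p u"
    using assms(1) unfolding attains_def by blast
  obtain v J where v: "J-lipschitz_on UNIV v" "admissible L b d v" "above_plane q v"
    using assms(2) unfolding attains_def by blast
  have "admissible L b (c + d) (\<lambda>y. u y + v y)"
    unfolding admissible_def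
  proof (intro allI impI)
    fix x y assume xy: "L * dist x y < b x"
    have "(b x - L * dist x y) * \<bar>(u y + v y) - (u x + v x)\<bar>
        \<le> (b x - L * dist x y) * (\<bar>u y - u x\<bar> + \<bar>v y - v x\<bar>)"
      using xy by (intro mult_left_mono) auto
    also have "\<dots> \<le> c * dist x y + d * dist x y"
      using u(2) v(2) xy unfolding admissible_def distrib_left by (intro add_mono) auto
    finally show "(b x - L * dist x y) * \<bar>(u y + v y) - (u x + v x)\<bar> \<le> (c + d) * dist x y"
      by (simp add: distrib_right)
  qed
  then show ?thesis
    unfolding attains_def using lipschitz_on_add[OF u(1) v(1)] above_plane_add[OF u(3) v(3)] by blast
qed

lemma attains_scaleR:
  assumes "attains L b p c" "r > 0"
  shows "attains L b (r *\<^sub>R p) (r * c)"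
proof -
  obtain u K where u: "K-lipschitz_on UNIV u" "admissible L b c u" "above_plane p u"
    using assms(1) unfolding attains_def by blast
  have "admissible L b (r * c) (\<lambda>y. r * u y)"
    unfolding admissible_def
  proof (intro allI impI)
    fix x y assume xy: "L * dist x y < b x"
    have "(b x - L * dist x y) * \<bar>r * u y - r * u x\<bar> = r * ((b x - L * dist x y) * \<bar>u y - u x\<bar>)"
      using assms(2) by (simp add: abs_mult flip: right_diff_distrib)
    also have "\<dots> \<le> r * (c * dist x y)"
      using u(2) xy assms(2) unfolding admissible_def by (intro mult_left_mono) auto
    finally show "(b x - L * dist x y) * \<bar>r * u y - r * u x\<bar> \<le> r * c * dist x y" by simp
  qed
  moreover have "(\<bar>r\<bar> * K)-lipschitz_on UNIV (\<lambda>y. r * u y)"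
    using lipschitz_on_cmult_real[OF u(1)] .
  ultimately show ?thesis
    unfolding attains_def using above_plane_scaleR[OF u(3) assms(2)] by blast
qed

lemma attains_mono:
  assumes "attains L b p c" "c \<le> d"
  shows "attains L b p d"
  using assms unfolding attains_def admissible_def
  by (meson mult_right_mono order_trans zero_le_dist)

text \<open>A shift changes a \<open>K\<close>-Lipschitz function by at most
  \<open>K * norm z\<close>, and any positive multiple of \<open>norm y\<close> absorbs this for
  large \<open>y\<close>. This is the invariance on which the zero-one law acts.\<close>

lemma attains_translate:
  assumes "attains L b p c"
  shows "attains L (\<lambda>x. b (x + z)) p c"
proof -
  obtain u K where u: "K-lipschitz_on UNIV u" "admissible L b c u" "above_plane p u"
    using assms unfolding attains_def by blast
  have K: "K \<ge> 0" using u(1) lipschitz_on_nonneg by blast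
  have 1: "K-lipschitz_on UNIV (\<lambda>x. u (x + z))"
    using lipschitz_onD[OF u(1)] K by (intro lipschitz_onI) (metis UNIV_I dist_add_cancel2)+
  have 2: "admissible L (\<lambda>x. b (x + z)) c (\<lambda>x. u (x + z))"
    using u(2) unfolding admissible_def by (metis dist_add_cancel2)
  have 3: "above_plane p (\<lambda>x. u (x + z))"
    unfolding above_plane_def
  proof (intro allI impI)
    fix e :: real assume e: "e > 0"
    obtain R where R: "\<And>y. R \<le> norm y \<Longrightarrow> - (e / 2) * norm y \<le> u y - p \<bullet> y"
      using u(3) e unfolding above_plane_def by (meson half_gt_zero)
    have "- e * norm y \<le> u (y + z) - p \<bullet> y" if y: "max R (2 * K * norm z / e) \<le> norm y" for y
    proof -
      have "u y - u (y + z) \<le> K * norm z"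
        using lipschitz_onD[OF u(1), of y "y + z"] by (simp add: dist_norm)
      moreover have "K * norm z \<le> (e / 2) * norm y" using y e by (simp add: field_simps)
      ultimately show ?thesis using R[of y] y by (simp add: algebra_simps)
    qed
    then show "\<exists>R. \<forall>y. R \<le> norm y \<longrightarrow> - e * norm y \<le> u (y + z) - p \<bullet> y" by blast
  qed
  show ?thesis unfolding attains_def using 1 2 3 by blast
qed

lemma ham_translate: "ham L (\<lambda>x. b (x + z)) p = ham L b p"
proof -
  have "attains L (\<lambda>x. b (x + z)) p c \<longleftrightarrow> attains L b p c" for c
    using attains_translate[of L b p c z] attains_translate[of L "\<lambda>x. b (x + z)" p c "- z"] by auto
  then show ?thesis by (simp add: ham_def)
qed

section \<open>Bounds and sublinearity of the Hamiltonian of one speed\<close>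

locale speed =
  fixes L :: real and b :: "'a::euclidean_space \<Rightarrow> real" and C :: real
  assumes lipschitz: "L-lipschitz_on UNIV b"
    and nonneg: "\<And>x. 0 \<le> b x" and bound: "\<And>x. b x \<le> C"
    and pos: "\<exists>x. 0 < b x"
begin

lemma L_nonneg: "0 \<le> L"
  using lipschitz lipschitz_on_nonneg by blast

lemma attains_nonneg:
  assumes "attains L b p c"
  shows "0 \<le> c"
proof -
  obtain u where u: "admissible L b c u" using assms unfolding attains_def by blast
  obtain x where x: "0 < b x" using pos by blast
  obtain e :: 'a where e: "norm e = 1" using vector_choose_size zero_le_one by blast
  \<comment> \<open>A radius with \<open>L * r < b x\<close>; the summand 1 allows
    \<open>L = 0\<close>.\<close>
  define r where "r = b x / (2 * (L + 1))"
  have r: "r > 0" using x L_nonneg by (simp add: r_def)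
  define y where "y = x + r *\<^sub>R e"
  have d: "dist x y = r" using r e by (simp add: y_def dist_norm)
  have "L * r < b x"
    using x L_nonneg by (simp add: r_def field_simps add_nonneg_pos)
  with u d have "(b x - L * r) * \<bar>u y - u x\<bar> \<le> c * r" unfolding admissible_def by metis
  moreover have "0 \<le> (b x - L * r) * \<bar>u y - u x\<bar>" using \<open>L * r < b x\<close> by simp
  ultimately have "0 \<le> c * r" by linarith
  then show ?thesis using r by (simp add: zero_le_mult_iff)
qed

lemma attains_plane: "attains L b p (C * norm p)"
proof -
  have "admissible L b (C * norm p) (\<lambda>y. p \<bullet> y)"
    unfolding admissible_def
  proof (intro allI impI)
    fix x y assume "L * dist x y < b x"
    have "0 \<le> L * dist x y" using L_nonneg by simp
    then have "b x - L * dist x y \<le> C" using bound[of x] by linarith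
    moreover have "\<bar>p \<bullet> y - p \<bullet> x\<bar> \<le> norm p * dist x y"
      using Cauchy_Schwarz_ineq2[of p "y - x"] by (simp add: dist_norm norm_minus_commute inner_diff_right)
    moreover have "0 \<le> C" using nonneg bound order_trans by blast
    ultimately have "(b x - L * dist x y) * \<bar>p \<bullet> y - p \<bullet> x\<bar> \<le> C * (norm p * dist x y)"
      by (intro mult_mono) auto
    then show "(b x - L * dist x y) * \<bar>p \<bullet> y - p \<bullet> x\<bar> \<le> C * norm p * dist x y" by simp
  qed
  moreover have "(norm p)-lipschitz_on UNIV (\<lambda>y. p \<bullet> y)"
    by (intro lipschitz_onI) (simp_all add: dist_norm Cauchy_Schwarz_ineq2 flip: inner_diff_right)
  moreover have "above_plane p (\<lambda>y. p \<bullet> y)" by (auto simp: above_plane_def)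
  ultimately show ?thesis unfolding attains_def by blast
qed

lemma ham_le: "attains L b p c \<Longrightarrow> ham L b p \<le> c"
  unfolding ham_def using attains_nonneg by (intro cInf_lower bdd_belowI[of _ 0]) auto

lemma ham_greatest: "(\<And>c. attains L b p c \<Longrightarrow> m \<le> c) \<Longrightarrow> m \<le> ham L b p"
  unfolding ham_def using attains_plane by (intro cInf_greatest) auto

lemma ham_nonneg: "0 \<le> ham L b p"
  by (rule ham_greatest) (rule attains_nonneg)

lemma ham_bound: "ham L b p \<le> C * norm p"
  by (rule ham_le[OF attains_plane])

text \<open>The strict inequality leaves room for a rational level \<open>d\<close>, which turns the
  infimum into a countable union of events. The bound \<open>0 \<le> d\<close> keeps the step costs
  of the chain distance nonnegative.\<close>

lemma ham_less_iff: "ham L b p < c \<longleftrightarrow> (\<exists>d\<in>\<rat>. 0 \<le> d \<and> d < c \<and> attains L b p d)"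
proof
  assume "ham L b p < c"
  then obtain d where d: "attains L b p d" "d < c"
    using ham_greatest[of p c] by (meson not_le)
  obtain q where "q \<in> \<rat>" "d < q" "q < c" using Rats_dense_in_real[OF d(2)] by blast
  with d show "\<exists>d\<in>\<rat>. 0 \<le> d \<and> d < c \<and> attains L b p d"
    using attains_mono attains_nonneg by (meson less_imp_le)
qed (use ham_le in \<open>fastforce intro: le_less_trans\<close>)

lemma ham_add: "ham L b (p + q) \<le> ham L b p + ham L b q"
proof -
  have "ham L b (p + q) - d \<le> ham L b p" if "attains L b q d" for d
    using ham_le[OF attains_add[OF _ that]] by (intro ham_greatest) (simp add: diff_le_eq)
  then have "ham L b (p + q) - ham L b p \<le> ham L b q"
    by (intro ham_greatest) (simp add: algebra_simps)
  then show ?thesis by simp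
qed

lemma ham_scaleR:
  assumes "r \<ge> 0" shows "ham L b (r *\<^sub>R p) = r * ham L b p"
proof -
  have le: "ham L b (r *\<^sub>R p) \<le> r * ham L b p" if "r > 0" for r p
  proof -
    have "ham L b (r *\<^sub>R p) / r \<le> ham L b p"
      using ham_le[OF attains_scaleR[OF _ that]] that by (intro ham_greatest) (simp add: field_simps)
    then show ?thesis using that by (simp add: field_simps)
  qed
  show ?thesis
  proof (cases "r = 0")
    case True
    then show ?thesis using ham_nonneg[of 0] ham_bound[of 0] by simp
  next
    case False
    then have r: "r > 0" using assms by simp
    have "ham L b p \<le> 1 / r * ham L b (r *\<^sub>R p)" using le[of "1 / r" "r *\<^sub>R p"] r by simp
    then show ?thesis using le[OF r, of p] r by (simp add: field_simps)
  qed
qed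

lemma convex_on_ham: "convex_on UNIV (ham L b)"
proof (rule convex_onI)
  fix t :: real and p q :: 'a assume "0 < t" "t < 1"
  then show "ham L b ((1 - t) *\<^sub>R p + t *\<^sub>R q) \<le> (1 - t) * ham L b p + t * ham L b q"
    using ham_add[of "(1 - t) *\<^sub>R p" "t *\<^sub>R q"] by (simp add: ham_scaleR)
qed simp

text \<open>Subadditivity turns the growth bound \<open>C * norm p\<close> into a Lipschitz constant
  that depends on \<open>C\<close> only.\<close>

lemma lipschitz_ham: "C-lipschitz_on UNIV (ham L b)"
proof (rule lipschitz_onI)
  show "0 \<le> C" using nonneg bound order_trans by blast
  have "ham L b p - ham L b q \<le> C * norm (p - q)" for p q
    using ham_add[of q "p - q"] ham_bound[of "p - q"] by simp
  then show "dist (ham L b p) (ham L b q) \<le> C * dist p q" for p q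
    by (metis abs_le_iff dist_norm dist_real_def minus_diff_eq norm_minus_commute)
qed

end

section \<open>The chain distance\<close>

text \<open>The largest increment that admissibility and a \<open>K\<close>-Lipschitz bound allow
  for this pair of points. Admissibility applies from either endpoint, and the larger speed gives
  the sharper bound, hence the maximum; it also makes the cost symmetric.\<close>

definition step_cost :: "real \<Rightarrow> ('a::metric_space \<Rightarrow> real) \<Rightarrow> real \<Rightarrow> real \<Rightarrow> 'a \<Rightarrow> 'a \<Rightarrow> real" where
  "step_cost L b K c x y =
    (if L * dist x y < max (b x) (b y)
     then min (K * dist x y) (c * dist x y / (max (b x) (b y) - L * dist x y))
     else K * dist x y)"

fun chain_cost :: "('a \<Rightarrow> 'a \<Rightarrow> real) \<Rightarrow> 'a \<Rightarrow> 'a list \<Rightarrow> real" where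
  "chain_cost S x [] = 0"
| "chain_cost S x (y # ys) = S x y + chain_cost S y ys"

lemma chain_cost_append:
  "chain_cost S x (xs @ ys) = chain_cost S x xs + chain_cost S (last (x # xs)) ys"
  by (induction xs arbitrary: x) auto

lemma step_cost_le: "step_cost L b K c x y \<le> K * dist x y"
  by (simp add: step_cost_def)

lemma step_cost_commute: "step_cost L b K c x y = step_cost L b K c y x"
  by (simp add: step_cost_def dist_commute max.commute)

lemma step_cost_nonneg:
  assumes "0 \<le> K" "0 \<le> c"
  shows "0 \<le> step_cost L b K c x y"
  using assms by (simp add: step_cost_def)

lemma chain_cost_nonneg:
  assumes "\<And>x y. 0 \<le> S x y"
  shows "0 \<le> chain_cost S x xs"
  using assms by (induction xs arbitrary: x) (auto intro: add_nonneg_nonneg)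

lemma admissible_step_cost:
  assumes u: "K-lipschitz_on UNIV u" and adm: "admissible L b c u"
  shows "\<bar>u y - u x\<bar> \<le> step_cost L b K c x y"
proof -
  have 1: "\<bar>u y - u x\<bar> \<le> K * dist x y"
    using lipschitz_onD[OF u, of y x] by (simp add: dist_real_def dist_commute)
  have 2: "(max (b x) (b y) - L * dist x y) * \<bar>u y - u x\<bar> \<le> c * dist x y"
    if "L * dist x y < max (b x) (b y)"
  proof (cases "b x \<ge> b y")
    case True
    with that show ?thesis using adm unfolding admissible_def by (simp add: max_def)
  next
    case False
    with that have "L * dist y x < b y" by (simp add: dist_commute)
    then have "(b y - L * dist y x) * \<bar>u x - u y\<bar> \<le> c * dist y x"
      using adm unfolding admissible_def by blast
    then show ?thesis using False by (simp add: dist_commute abs_minus_commute)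
  qed
  show ?thesis
    using 1 2 by (auto simp: step_cost_def pos_le_divide_eq mult.commute)
qed

lemma increment_le_chain_cost:
  assumes "\<And>x y. u y - u x \<le> S x y"
  shows "u (last (x # xs)) - u x \<le> chain_cost S x xs"
proof (induction xs arbitrary: x)
  case (Cons y ys)
  show ?case using Cons.IH[of y] assms[of y x] by simp
qed simp

locale dense_set =
  fixes D :: "'a::euclidean_space set"
  assumes dense: "\<And>X. open X \<Longrightarrow> X \<noteq> {} \<Longrightarrow> \<exists>x\<in>D. x \<in> X"
begin

lemma approx:
  obtains X where "\<And>n. X n \<in> D" "X \<longlonglongrightarrow> x"
proof -
  have "\<exists>z\<in>D. dist z x < inverse (Suc n)" for n
    using dense[of "ball x (inverse (Suc n))"] by (auto simp: dist_commute)
  then obtain X where X: "\<And>n. X n \<in> D" "\<And>n. dist (X n) x < inverse (Suc n)" by metis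
  have "(\<lambda>n. dist (X n) x) \<longlonglongrightarrow> 0"
    using X(2) by (intro tendsto_sandwich[OF _ _ tendsto_const LIMSEQ_inverse_real_of_nat])
      (auto intro!: always_eventually less_imp_le)
  then have "X \<longlonglongrightarrow> x" using tendsto_dist_iff by blast
  with X(1) show ?thesis by (rule that)
qed

end

text \<open>The last leg is charged at the rate \<open>K\<close>, so the endpoint \<open>y\<close>
  is unrestricted and the infimum is \<open>K\<close>-Lipschitz. Only the intermediate nodes lie in
  \<open>D\<close>; the start is the origin.\<close>

definition chain_dist :: "real \<Rightarrow> ('a::euclidean_space \<Rightarrow> real) \<Rightarrow> 'a set \<Rightarrow> real \<Rightarrow> real \<Rightarrow> 'a \<Rightarrow> real" where
  "chain_dist L b D K c y =
    (INF xs\<in>lists D. chain_cost (step_cost L b K c) 0 xs + K * dist (last (0 # xs)) y)"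

context
  fixes L :: real and b :: "'a::euclidean_space \<Rightarrow> real" and D :: "'a set" and K c :: real
  assumes K: "0 \<le> K" and c: "0 \<le> c"
begin

lemma chain_dist_le:
  assumes "xs \<in> lists D"
  shows "chain_dist L b D K c y \<le> chain_cost (step_cost L b K c) 0 xs + K * dist (last (0 # xs)) y"
  unfolding chain_dist_def
proof (rule cINF_lower[OF bdd_belowI2[where m = 0] assms])
  fix xs
  have "0 \<le> K * dist (last (0 # xs)) y" using K by simp
  then show "0 \<le> chain_cost (step_cost L b K c) 0 xs + K * dist (last (0 # xs)) y"
    using chain_cost_nonneg[of "step_cost L b K c" 0 xs] step_cost_nonneg[OF K c] by (metis add_nonneg_nonneg)
qed

lemma chain_dist_greatest:
  assumes "\<And>xs. xs \<in> lists D \<Longrightarrow> m \<le> chain_cost (step_cost L b K c) 0 xs + K * dist (last (0 # xs)) y"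
  shows "m \<le> chain_dist L b D K c y"
  unfolding chain_dist_def using assms by (intro cINF_greatest) auto

lemma lipschitz_chain_dist: "K-lipschitz_on UNIV (chain_dist L b D K c)"
proof (rule lipschitz_onI)
  have "chain_dist L b D K c y - K * dist x y \<le> chain_dist L b D K c x" for x y
  proof (rule chain_dist_greatest)
    fix xs assume xs: "xs \<in> lists D"
    have "K * dist (last (0 # xs)) y \<le> K * (dist (last (0 # xs)) x + dist x y)"
      using K by (intro mult_left_mono dist_triangle)
    with chain_dist_le[OF xs, of y]
    show "chain_dist L b D K c y - K * dist x y \<le> chain_cost (step_cost L b K c) 0 xs + K * dist (last (0 # xs)) x"
      by (simp add: distrib_left)
  qed
  from this this[of _ x for x] show "dist (chain_dist L b D K c x) (chain_dist L b D K c y) \<le> K * dist x y" for x y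
    unfolding dist_real_def by (smt (verit) dist_commute)
qed (rule K)

lemma chain_dist_step:
  assumes "x \<in> D" "y \<in> D"
  shows "\<bar>chain_dist L b D K c y - chain_dist L b D K c x\<bar> \<le> step_cost L b K c x y"
proof -
  have "chain_dist L b D K c y - step_cost L b K c x y \<le> chain_dist L b D K c x" if "x \<in> D" "y \<in> D" for x y
  proof (rule chain_dist_greatest)
    fix xs assume xs: "xs \<in> lists D"
    \<comment> \<open>The detour through \<open>x\<close> replaces the last leg of \<open>xs\<close>
      by a step that costs no more, and then the step to \<open>y\<close> is charged at its own
      cost.\<close>
    then have "xs @ [x, y] \<in> lists D" using that by simp
    from chain_dist_le[OF this, of y]
    have "chain_dist L b D K c y \<le> chain_cost (step_cost L b K c) 0 xs
        + step_cost L b K c (last (0 # xs)) x + step_cost L b K c x y"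
      by (simp add: chain_cost_append del: last.simps) simp
    with step_cost_le[of L b K c "last (0 # xs)" x]
    show "chain_dist L b D K c y - step_cost L b K c x y
        \<le> chain_cost (step_cost L b K c) 0 xs + K * dist (last (0 # xs)) x" by linarith
  qed
  from this[OF assms] this[OF assms(2,1)] show ?thesis
    by (simp add: step_cost_commute[of L b K c y x] abs_le_iff)
qed

text \<open>Between points of \<open>D\<close> this is \<open>chain_dist_step\<close>; density and
  continuity extend it. Along the approximating pairs the gap is eventually positive, so the
  division in \<open>step_cost\<close> can be undone before the limit is taken.\<close>

lemma admissible_chain_dist:
  assumes "dense_set D" and b: "continuous_on UNIV b"
  shows "admissible L b c (chain_dist L b D K c)"
  unfolding admissible_def
proof (intro allI impI)
  let ?m = "chain_dist L b D K c"
  interpret dense_set D by fact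
  fix x y assume xy: "L * dist x y < b x"
  obtain X where X: "\<And>n. X n \<in> D" "X \<longlonglongrightarrow> x" using approx by blast
  obtain Y where Y: "\<And>n. Y n \<in> D" "Y \<longlonglongrightarrow> y" using approx by blast
  have m: "isCont ?m z" for z
    using lipschitz_on_continuous_on[OF lipschitz_chain_dist] by (simp add: continuous_on_eq_continuous_at)
  have bz: "isCont b z" for z
    using b by (simp add: continuous_on_eq_continuous_at)
  have bX: "(\<lambda>n. b (X n)) \<longlonglongrightarrow> b x" by (rule isCont_tendsto_compose[OF bz X(2)])
  have dXY: "(\<lambda>n. dist (X n) (Y n)) \<longlonglongrightarrow> dist x y" by (intro tendsto_dist X Y)
  have gap: "(\<lambda>n. b (X n) - L * dist (X n) (Y n)) \<longlonglongrightarrow> b x - L * dist x y"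
    by (intro tendsto_intros bX dXY)
  have gap_pos: "\<forall>\<^sub>F n in sequentially. 0 < b (X n) - L * dist (X n) (Y n)"
    using order_tendstoD(1)[OF gap, of 0] xy by simp
  have ev: "\<forall>\<^sub>F n in sequentially. (b (X n) - L * dist (X n) (Y n)) * \<bar>?m (Y n) - ?m (X n)\<bar> \<le> c * dist (X n) (Y n)"
    using gap_pos
  proof eventually_elim
    case (elim n)
    let ?x = "X n" and ?y = "Y n"
    have gt: "L * dist ?x ?y < max (b ?x) (b ?y)" using elim by simp
    have "\<bar>?m ?y - ?m ?x\<bar> \<le> c * dist ?x ?y / (max (b ?x) (b ?y) - L * dist ?x ?y)"
      using chain_dist_step[OF X(1) Y(1), of n n] gt by (simp add: step_cost_def)
    then have "(max (b ?x) (b ?y) - L * dist ?x ?y) * \<bar>?m ?y - ?m ?x\<bar> \<le> c * dist ?x ?y"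
      using gt by (simp add: pos_le_divide_eq mult.commute)
    moreover have "(b ?x - L * dist ?x ?y) * \<bar>?m ?y - ?m ?x\<bar> \<le> (max (b ?x) (b ?y) - L * dist ?x ?y) * \<bar>?m ?y - ?m ?x\<bar>"
      by (intro mult_right_mono) auto
    ultimately show ?case by linarith
  qed
  have "(\<lambda>n. (b (X n) - L * dist (X n) (Y n)) * \<bar>?m (Y n) - ?m (X n)\<bar>) \<longlonglongrightarrow> (b x - L * dist x y) * \<bar>?m y - ?m x\<bar>"
    by (intro tendsto_intros gap isCont_tendsto_compose[OF m] X Y)
  moreover have "(\<lambda>n. c * dist (X n) (Y n)) \<longlonglongrightarrow> c * dist x y"
    by (intro tendsto_intros dXY)
  ultimately show "(b x - L * dist x y) * \<bar>?m y - ?m x\<bar> \<le> c * dist x y"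
    using ev by (intro tendsto_le[OF sequentially_bot])
qed

end

text \<open>This says that \<open>chain_dist\<close> stays asymptotically above the plane, with the
  infimum written out over chains, the slack replaced by \<open>1 / Suc n\<close> and
  \<open>y\<close> restricted to \<open>D\<close>. For countable \<open>D\<close> every quantifier
  is countable.\<close>

definition chain_above :: "real \<Rightarrow> ('a::euclidean_space \<Rightarrow> real) \<Rightarrow> 'a set \<Rightarrow> real \<Rightarrow> real \<Rightarrow> 'a \<Rightarrow> bool" where
  "chain_above L b D K c p \<longleftrightarrow>
    (\<forall>n::nat. \<exists>R::nat. \<forall>y\<in>D. real R \<le> norm y \<longrightarrow> (\<forall>xs\<in>lists D.
      - norm y / Suc n \<le> chain_cost (step_cost L b K c) 0 xs + K * dist (last (0 # xs)) y - p \<bullet> y))"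

text \<open>The chain distance is the largest admissible \<open>K\<close>-Lipschitz function that vanishes at the
  origin, so only this function has to be compared with the plane.\<close>

lemma attains_iff_chain_above:
  assumes "dense_set D" and b: "continuous_on UNIV b" and c: "0 \<le> c"
  shows "attains L b p c \<longleftrightarrow> (\<exists>K::nat. chain_above L b D (real K) c p)"
proof
  assume "attains L b p c"
  then obtain u K' where u': "K'-lipschitz_on UNIV u" and adm: "admissible L b c u" and above: "above_plane p u"
    unfolding attains_def by blast
  obtain K :: nat where "K' \<le> real K" using real_arch_simple by blast
  with u' have u: "(real K)-lipschitz_on UNIV u" by (auto intro: lipschitz_on_le)
  have S: "u y - u x \<le> step_cost L b (real K) c x y" for x y
    using admissible_step_cost[OF u adm, of y x] by linarith
  have "chain_above L b D (real K) c p"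
    unfolding chain_above_def
  proof
    fix n :: nat
    \<comment> \<open>One half of \<open>1 / Suc n\<close> pays for the slack of \<open>u\<close>
      above the plane, the other half for the value \<open>u 0\<close>.\<close>
    define e where "e = 1 / (2 * real (Suc n))"
    have e: "e > 0" by (simp add: e_def)
    then obtain R where R: "\<And>y. R \<le> norm y \<Longrightarrow> - e * norm y \<le> u y - p \<bullet> y"
      using above unfolding above_plane_def by blast
    obtain R' :: nat where R': "max R (\<bar>u 0\<bar> / e) \<le> real R'" using real_arch_simple by blast
    show "\<exists>R::nat. \<forall>y\<in>D. real R \<le> norm y \<longrightarrow> (\<forall>xs\<in>lists D.
      - norm y / Suc n \<le> chain_cost (step_cost L b (real K) c) 0 xs + real K * dist (last (0 # xs)) y - p \<bullet> y)"
    proof (intro exI[of _ R'] ballI impI)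
      fix y :: 'a and xs assume y: "real R' \<le> norm y"
      have "u (last (0 # xs)) - u 0 \<le> chain_cost (step_cost L b (real K) c) 0 xs"
        by (rule increment_le_chain_cost[OF S])
      moreover have "u y - u (last (0 # xs)) \<le> real K * dist (last (0 # xs)) y"
        using lipschitz_onD[OF u, of y "last (0 # xs)"] by (simp add: dist_real_def dist_commute)
      moreover have "- e * norm y \<le> u y - p \<bullet> y" using R[of y] R' y by simp
      moreover have "\<bar>u 0\<bar> / e \<le> norm y" using R' y by linarith
      then have "\<bar>u 0\<bar> \<le> e * norm y" using e by (simp add: field_simps)
      moreover have "norm y / Suc n = 2 * (e * norm y)" by (simp add: e_def field_simps)
      ultimately show "- norm y / Suc n \<le> chain_cost (step_cost L b (real K) c) 0 xs + real K * dist (last (0 # xs)) y - p \<bullet> y"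
        by linarith
    qed
  qed
  then show "\<exists>K::nat. chain_above L b D (real K) c p" by blast
next
  assume "\<exists>K::nat. chain_above L b D (real K) c p"
  then obtain K :: nat where K: "chain_above L b D (real K) c p" by blast
  interpret dense_set D by fact
  let ?m = "chain_dist L b D (real K) c"
  have lip: "(real K)-lipschitz_on UNIV ?m" using c by (intro lipschitz_chain_dist) auto
  have adm: "admissible L b c ?m" using c by (intro admissible_chain_dist[OF _ _ assms(1,2)]) auto
  have "above_plane p ?m"
    unfolding above_plane_def
  proof (intro allI impI)
    fix e :: real assume "0 < e"
    then obtain n where n: "inverse (Suc n) < e" using reals_Archimedean by blast
    from K obtain R :: nat where R: "\<And>y xs. y \<in> D \<Longrightarrow> real R \<le> norm y \<Longrightarrow> xs \<in> lists D \<Longrightarrow>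
      - norm y / Suc n \<le> chain_cost (step_cost L b (real K) c) 0 xs + real K * dist (last (0 # xs)) y - p \<bullet> y"
      unfolding chain_above_def by meson
    have D: "- norm y / Suc n \<le> ?m y - p \<bullet> y" if "y \<in> D" "real R \<le> norm y" for y
    proof -
      have "p \<bullet> y - norm y / Suc n \<le> ?m y"
      proof (rule chain_dist_greatest)
        fix xs assume "xs \<in> lists D"
        from R[OF that this] show "p \<bullet> y - norm y / Suc n
            \<le> chain_cost (step_cost L b (real K) c) 0 xs + real K * dist (last (0 # xs)) y" by linarith
      qed (use c in auto)
      then show ?thesis by simp
    qed
    show "\<exists>R. \<forall>y. R \<le> norm y \<longrightarrow> - e * norm y \<le> ?m y - p \<bullet> y"
    \<comment> \<open>The margin 1 puts the points of \<open>D\<close> that approach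
      \<open>y\<close> eventually outside radius \<open>R\<close>.\<close>
    proof (intro exI[of _ "real R + 1"] allI impI)
      fix y :: 'a assume y: "real R + 1 \<le> norm y"
      obtain Y where Y: "\<And>k. Y k \<in> D" "Y \<longlonglongrightarrow> y" using approx by blast
      have "\<forall>\<^sub>F k in sequentially. real R < norm (Y k)"
        using y by (intro order_tendstoD(1)[OF tendsto_norm[OF Y(2)]]) simp
      then have ev: "\<forall>\<^sub>F k in sequentially. - norm (Y k) / Suc n \<le> ?m (Y k) - p \<bullet> Y k"
        by eventually_elim (use D Y(1) in simp)
      have m: "isCont ?m y"
        using lipschitz_on_continuous_on[OF lip] by (simp add: continuous_on_eq_continuous_at)
      have "(\<lambda>k. - norm (Y k) / Suc n) \<longlonglongrightarrow> - norm y / Suc n"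
        using Y(2) by (intro tendsto_intros) auto
      moreover have "(\<lambda>k. ?m (Y k) - p \<bullet> Y k) \<longlonglongrightarrow> ?m y - p \<bullet> y"
        by (intro tendsto_intros isCont_tendsto_compose[OF m] Y(2))
      ultimately have "- norm y / Suc n \<le> ?m y - p \<bullet> y"
        using ev by (intro tendsto_le[OF sequentially_bot])
      moreover have "inverse (Suc n) * norm y \<le> e * norm y" using n by (intro mult_right_mono) auto
      moreover have "- norm y / Suc n = - (inverse (Suc n) * norm y)" by (simp add: divide_inverse mult.commute)
      ultimately show "- e * norm y \<le> ?m y - p \<bullet> y" by linarith
    qed
  qed
  with lip adm show "attains L b p c" unfolding attains_def by blast
qed

section \<open>Gradient bounds\<close>

lemma AE_lborel_translate:
  assumes "AE x in lborel. P (x::'a::euclidean_space)"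
  shows "AE x in lborel. P (x + w)"
proof -
  obtain N where N: "{x \<in> space lborel. \<not> P x} \<subseteq> N" "emeasure lborel N = 0" "N \<in> sets lborel"
    by (rule AE_E[OF assms])
  have "emeasure lborel N = emeasure (distr lborel borel ((+) w)) N"
    by (simp add: lborel_distr_plus)
  also have "\<dots> = emeasure lborel ((+) w -` N)"
    using N(3) by (subst emeasure_distr) auto
  finally have "emeasure lborel ((+) w -` N) = 0" using N(2) by simp
  moreover have "(+) w -` N \<in> sets lborel"
    using N(3) measurable_sets[of "(+) w" borel borel N] by auto
  ultimately have "(+) w -` N \<in> null_sets lborel" by (simp add: null_sets_def)
  then show ?thesis
    by (rule AE_I') (use N(1) in \<open>auto simp: add.commute\<close>)
qed

lemma has_derivative_directional:
  fixes f :: "'a::euclidean_space \<Rightarrow> real"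
  assumes "(f has_derivative (\<lambda>h. h \<bullet> g)) (at x)"
  shows "((\<lambda>h. (f (x + h *\<^sub>R v) - f x) / h) \<longlongrightarrow> v \<bullet> g) (at 0)"
proof -
  have "((\<lambda>t. f (x + t *\<^sub>R v)) has_derivative (\<lambda>t. (t *\<^sub>R v) \<bullet> g)) (at 0)"
    by (rule has_derivative_compose[of "\<lambda>t. x + t *\<^sub>R v" "\<lambda>t. t *\<^sub>R v" 0 UNIV f "\<lambda>h. h \<bullet> g"])
       (auto intro!: derivative_eq_intros assms)
  then have "((\<lambda>t. f (x + t *\<^sub>R v)) has_real_derivative (v \<bullet> g)) (at 0)"
    by (simp add: has_field_derivative_def mult_commute_abs)
  then show ?thesis by (simp add: DERIV_def)
qed

lemma abs_integral_indicator_le: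
  fixes g :: "'a::euclidean_space \<Rightarrow> real"
  assumes B[measurable]: "B \<in> sets borel" and g[measurable]: "g \<in> borel_measurable borel"
    and bdd: "bounded B" and bound: "AE x in lborel. x \<in> B \<longrightarrow> \<bar>g x\<bar> \<le> C"
  shows "\<bar>LINT x|lborel. indicator B x * g x\<bar> \<le> C * measure lborel B"
proof -
  have int: "integrable lborel (\<lambda>x. indicator B x * g x)"
    by (rule integrable_indicator_mult[OF B g bdd bound])
  have "\<bar>LINT x|lborel. indicator B x * g x\<bar> \<le> (LINT x|lborel. \<bar>indicator B x * g x\<bar>)"
    by (rule integral_abs_bound)
  also have "\<dots> \<le> (LINT x|lborel. C * indicator B x)"
  proof (rule integral_mono_AE)
    show "integrable lborel (\<lambda>x. \<bar>indicator B x * g x\<bar>)" using int by (rule integrable_abs)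
    show "integrable lborel (\<lambda>x. C * indicator B x :: real)"
      using emeasure_bounded_finite[OF bdd]
      by (intro integrable_mult_right integrable_real_indicator) simp_all
    show "AE x in lborel. \<bar>indicator B x * g x\<bar> \<le> C * indicator B x"
      using bound by eventually_elim (auto simp: indicator_def)
  qed
  also have "\<dots> = C * measure lborel B" by simp
  finally show ?thesis .
qed

text \<open>The average over \<open>B\<close> is differentiable at every \<open>t\<close>, even if
  \<open>u\<close> fails to be differentiable along an entire segment: the difference quotients are
  bounded by \<open>K * norm v\<close> and converge for almost every starting point.\<close>

lemma has_derivative_integral_translate:
  fixes u :: "'a::euclidean_space \<Rightarrow> real"
  assumes u: "K-lipschitz_on UNIV u" and g[measurable]: "g \<in> borel_measurable borel"
    and deriv: "AE x in lborel. (u has_derivative (\<lambda>h. h \<bullet> g x)) (at x)"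
    and B[measurable]: "B \<in> sets borel" and bdd: "bounded B"
  shows "((\<lambda>t. LINT z|lborel. indicator B z * u (z + t *\<^sub>R v)) has_real_derivative
          (LINT z|lborel. indicator B z * (v \<bullet> g (z + t *\<^sub>R v)))) (at t)"
proof -
  have [measurable]: "u \<in> borel_measurable borel"
    by (intro borel_measurable_continuous_onI lipschitz_on_continuous_on[OF u])
  have K: "K \<ge> 0" using u lipschitz_on_nonneg by blast
  have int: "integrable lborel (\<lambda>z. indicator B z * u (z + w))" for w
  proof -
    obtain R where R: "\<And>z. z \<in> B \<Longrightarrow> norm z \<le> R" using bdd by (auto simp: bounded_iff)
    have "\<bar>u (z + w)\<bar> \<le> \<bar>u w\<bar> + K * R" if "z \<in> B" for z
    proof -
      have "\<bar>u (z + w) - u w\<bar> \<le> K * norm z"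
        using lipschitz_onD[OF u, of "z + w" w] by (simp add: dist_norm)
      also have "\<dots> \<le> K * R" using R[OF that] K by (rule mult_left_mono)
      finally show ?thesis by linarith
    qed
    then show ?thesis by (intro integrable_indicator_mult[OF B _ bdd] AE_I2 impI) measurable
  qed
  let ?\<phi> = "\<lambda>t. LINT z|lborel. indicator B z * u (z + t *\<^sub>R v)"
  let ?Q = "\<lambda>h z. (u ((z + t *\<^sub>R v) + h *\<^sub>R v) - u (z + t *\<^sub>R v)) / h"
  have quot: "(?\<phi> (t + h) - ?\<phi> t) / h = (LINT z|lborel. indicator B z * ?Q h z)" for h
  proof -
    have "(LINT z|lborel. indicator B z * ?Q h z)
        = (LINT z|lborel. (indicator B z * u (z + (t + h) *\<^sub>R v) - indicator B z * u (z + t *\<^sub>R v)) / h)"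
      by (intro Bochner_Integration.integral_cong refl) (simp add: scaleR_add_left add.assoc right_diff_distrib)
    also have "\<dots> = (?\<phi> (t + h) - ?\<phi> t) / h"
      using Bochner_Integration.integral_diff[OF int int] by simp
    finally show ?thesis by (rule sym)
  qed
  show ?thesis
    unfolding DERIV_def quot tendsto_at_iff_sequentially
  proof (intro allI impI)
    fix X :: "nat \<Rightarrow> real" assume X: "\<forall>i. X i \<in> UNIV - {0}" "X \<longlonglongrightarrow> 0"
    then have X0: "filterlim X (at 0) sequentially" by (intro filterlim_atI) auto
    show "((\<lambda>h. LINT z|lborel. indicator B z * ?Q h z) \<circ> X)
        \<longlonglongrightarrow> (LINT z|lborel. indicator B z * (v \<bullet> g (z + t *\<^sub>R v)))"
      unfolding o_def
    proof (rule integral_dominated_convergence[where w = "\<lambda>z. K * norm v * indicator B z"])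
      show "integrable lborel (\<lambda>z. K * norm v * indicator B z :: real)"
        using emeasure_bounded_finite[OF bdd]
        by (intro integrable_mult_right integrable_real_indicator) simp_all
      show "AE z in lborel. (\<lambda>n. indicator B z * ?Q (X n) z) \<longlonglongrightarrow> indicator B z * (v \<bullet> g (z + t *\<^sub>R v))"
        using AE_lborel_translate[OF deriv, of "t *\<^sub>R v"]
      proof eventually_elim
        case (elim z)
        show ?case
          by (rule tendsto_mult[OF tendsto_const filterlim_compose[OF has_derivative_directional[OF elim] X0]])
      qed
      show "AE z in lborel. norm (indicator B z * ?Q (X n) z) \<le> K * norm v * indicator B z" for n
        using lipschitz_quotient_bound[OF u] by (intro AE_I2) (auto simp: indicator_def)
    qed measurable
  qed
qed

context speed
begin

text \<open>Averaging the increment over a small ball of starting points makes the null set where the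
  gradient is unknown invisible along almost all of the parallel segments.\<close>

lemma admissible_if_gradient_bound:
  assumes u: "K-lipschitz_on UNIV u" and g[measurable]: "g \<in> borel_measurable borel"
    and deriv: "AE x in lborel. (u has_derivative (\<lambda>h. h \<bullet> g x)) (at x)"
    and bound: "AE x in lborel. b x * norm (g x) \<le> c"
  shows "admissible L b c u"
  unfolding admissible_def
proof (intro allI impI)
  fix x y assume xy: "L * dist x y < b x"
  have [measurable]: "u \<in> borel_measurable borel"
    by (intro borel_measurable_continuous_onI lipschitz_on_continuous_on[OF u])
  define v where "v = y - x"
  define d where "d = dist x y"
  have d: "norm v = d" "0 \<le> d" by (simp_all add: v_def d_def dist_norm norm_minus_commute)
  have K: "K \<ge> 0" using u lipschitz_on_nonneg by blast
  have main: "(b x - L * (d + r)) * \<bar>u y - u x\<bar> \<le> c * d + 2 * K * r * (b x - L * (d + r))"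
    if r: "0 < r" "L * (d + r) < b x" for r
  proof -
    \<comment> \<open>A lower bound for \<open>b\<close> on all the parallel segments that start in
      the ball \<open>?B\<close>, because their points are within \<open>d + r\<close> of
      \<open>x\<close>.\<close>
    define m where "m = b x - L * (d + r)"
    have m: "m > 0" using r by (simp add: m_def)
    let ?B = "ball x r"
    have \<beta>: "measure lborel ?B > 0" using content_ball_pos[of r x] r by simp
    let ?\<phi> = "\<lambda>t. LINT z|lborel. indicator ?B z * u (z + t *\<^sub>R v)"
    let ?\<phi>' = "\<lambda>t. LINT z|lborel. indicator ?B z * (v \<bullet> g (z + t *\<^sub>R v))"
    have "DERIV ?\<phi> t :> ?\<phi>' t" for t
      by (rule has_derivative_integral_translate[OF u g deriv]) auto
    \<comment> \<open>The mean value theorem selects a single time \<open>t\<close>; at this fixed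
      time the gradient bound is available for almost every starting point \<open>z\<close>.\<close>
    then obtain t where t: "0 < t" "t < 1" "?\<phi> 1 - ?\<phi> 0 = ?\<phi>' t"
      using MVT2[of 0 1 ?\<phi> ?\<phi>'] by auto
    have "AE z in lborel. z \<in> ?B \<longrightarrow> \<bar>v \<bullet> g (z + t *\<^sub>R v)\<bar> \<le> d * (c / m)"
      using AE_lborel_translate[OF bound, of "t *\<^sub>R v"]
    proof (eventually_elim, intro impI)
      fix z assume z: "b (z + t *\<^sub>R v) * norm (g (z + t *\<^sub>R v)) \<le> c" "z \<in> ?B"
      let ?q = "z + t *\<^sub>R v"
      have "dist x ?q \<le> norm (x - z) + norm (t *\<^sub>R v)"
        unfolding dist_norm by (metis diff_diff_eq norm_triangle_ineq4)
      also have "\<dots> \<le> r + d" using z(2) t d by (intro add_mono) (auto simp: dist_norm mult_left_le_one_le)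
      finally have "L * dist x ?q \<le> L * (d + r)" using L_nonneg by (intro mult_left_mono) auto
      moreover have "b x - b ?q \<le> L * dist x ?q"
        using lipschitz_onD[OF lipschitz, of x ?q] by (simp add: dist_real_def)
      ultimately have "m \<le> b ?q" by (simp add: m_def)
      then have "m * norm (g ?q) \<le> b ?q * norm (g ?q)" by (rule mult_right_mono) simp
      with z(1) have "m * norm (g ?q) \<le> c" by linarith
      then have "norm (g ?q) \<le> c / m" using m by (simp add: pos_le_divide_eq mult.commute)
      then have "norm v * norm (g ?q) \<le> d * (c / m)" unfolding d(1) using d(2) by (rule mult_left_mono)
      with Cauchy_Schwarz_ineq2[of v "g ?q"] show "\<bar>v \<bullet> g ?q\<bar> \<le> d * (c / m)" by linarith
    qed
    then have 1: "\<bar>?\<phi>' t\<bar> \<le> d * (c / m) * measure lborel ?B"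
      by (intro abs_integral_indicator_le) auto
    have incr: "?\<phi> 1 - ?\<phi> 0 - (u y - u x) * measure lborel ?B
        = (LINT z|lborel. indicator ?B z * ((u (z + v) - u z) - (u y - u x)))"
    proof -
      have bd: "\<bar>u (z + w) - u (x + w)\<bar> \<le> K * r" if "z \<in> ?B" for z w
      proof -
        have "\<bar>u (z + w) - u (x + w)\<bar> \<le> K * dist z x"
          using lipschitz_onD[OF u, of "z + w" "x + w"] by (simp add: dist_real_def)
        also have "\<dots> \<le> K * r" using that K by (intro mult_left_mono) (auto simp: dist_commute)
        finally show ?thesis .
      qed
      have int: "integrable lborel (\<lambda>z. indicator ?B z * u (z + w))" for w
      proof (rule integrable_indicator_mult[where C = "\<bar>u (x + w)\<bar> + K * r"])
        show "AE z in lborel. z \<in> ?B \<longrightarrow> \<bar>u (z + w)\<bar> \<le> \<bar>u (x + w)\<bar> + K * r"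
        proof (intro AE_I2 impI)
          fix z assume "z \<in> ?B"
          from bd[OF this, of w] show "\<bar>u (z + w)\<bar> \<le> \<bar>u (x + w)\<bar> + K * r" by linarith
        qed
      qed auto
      have ic: "integrable lborel (\<lambda>z. indicator ?B z * (u y - u x))"
        by (rule integrable_indicator_mult[where C = "\<bar>u y - u x\<bar>"]) auto
      have "(LINT z|lborel. indicator ?B z * ((u (z + v) - u z) - (u y - u x)))
        = (LINT z|lborel. (indicator ?B z * u (z + v) - indicator ?B z * u (z + 0)) - indicator ?B z * (u y - u x))"
        by (intro Bochner_Integration.integral_cong refl) (simp add: right_diff_distrib)
      also have "\<dots> = (LINT z|lborel. indicator ?B z * u (z + v)) - (LINT z|lborel. indicator ?B z * u (z + 0))
          - (LINT z|lborel. indicator ?B z * (u y - u x))"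
        by (simp only: Bochner_Integration.integral_diff[OF int int]
            Bochner_Integration.integral_diff[OF Bochner_Integration.integrable_diff[OF int int] ic])
      finally show ?thesis by (simp add: mult.commute)
    qed
    \<comment> \<open>Replacing the increment that starts at \<open>z\<close> by the one that starts
      at \<open>x\<close> costs at most \<open>K * r\<close> at each end.\<close>
    have "AE z in lborel. z \<in> ?B \<longrightarrow> \<bar>(u (z + v) - u z) - (u y - u x)\<bar> \<le> 2 * K * r"
    proof (intro AE_I2 impI)
      fix z assume "z \<in> ?B"
      then have "K * dist z x \<le> K * r" using K by (intro mult_left_mono) (auto simp: dist_commute)
      moreover have "\<bar>u (z + v) - u y\<bar> \<le> K * dist z x"
        using lipschitz_onD[OF u, of "z + v" y] by (simp add: dist_norm v_def algebra_simps)
      moreover have "\<bar>u z - u x\<bar> \<le> K * dist z x"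
        using lipschitz_onD[OF u, of z x] by (simp add: dist_real_def)
      ultimately show "\<bar>(u (z + v) - u z) - (u y - u x)\<bar> \<le> 2 * K * r" by linarith
    qed
    then have 2: "\<bar>?\<phi> 1 - ?\<phi> 0 - (u y - u x) * measure lborel ?B\<bar> \<le> 2 * K * r * measure lborel ?B"
      unfolding incr by (intro abs_integral_indicator_le) auto
    have "\<bar>(u y - u x) * measure lborel ?B\<bar> \<le> (d * (c / m) + 2 * K * r) * measure lborel ?B"
      using 1 2 unfolding t(3) distrib_right by linarith
    then have "\<bar>u y - u x\<bar> \<le> d * (c / m) + 2 * K * r" using \<beta> by (simp add: abs_mult)
    then have "m * \<bar>u y - u x\<bar> \<le> m * (d * (c / m) + 2 * K * r)" using m by (intro mult_left_mono) auto
    also have "\<dots> = c * d + 2 * K * r * m" using m by (simp add: field_simps)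
    finally show ?thesis by (simp add: m_def)
  qed
  have "((\<lambda>r. b x - L * (d + r)) \<longlongrightarrow> b x - L * (d + 0)) (at_right 0)" by (intro tendsto_intros)
  then have "\<forall>\<^sub>F r in at_right 0. 0 < b x - L * (d + r)"
    using xy by (intro order_tendstoD(1)) (auto simp: d_def)
  then have ev: "\<forall>\<^sub>F r in at_right 0. (b x - L * (d + r)) * \<bar>u y - u x\<bar> \<le> c * d + 2 * K * r * (b x - L * (d + r))"
    using eventually_at_right_less[of "0::real"] by eventually_elim (use main in simp)
  have "(b x - L * (d + 0)) * \<bar>u y - u x\<bar> \<le> c * d + 2 * K * 0 * (b x - L * (d + 0))"
    by (rule tendsto_le[OF trivial_limit_at_right_real _ _ ev]; intro tendsto_intros)
  then show "(b x - L * dist x y) * \<bar>u y - u x\<bar> \<le> c * dist x y" by (simp add: d_def)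
qed

text \<open>Move in the direction \<open>g\<close> itself: the quotient tends to
  \<open>g \<bullet> g\<close>, the distance contributes one factor \<open>norm g\<close>, and this
  factor cancels.\<close>

lemma gradient_bound_if_admissible:
  assumes adm: "admissible L b c u" and c: "0 \<le> c" and x: "0 < b x"
    and deriv: "(u has_derivative (\<lambda>h. h \<bullet> g)) (at x)"
  shows "b x * norm g \<le> c"
proof (cases "g = 0")
  case False
  let ?Q = "\<lambda>h. (u (x + h *\<^sub>R g) - u x) / h"
  have Q: "(?Q \<longlongrightarrow> g \<bullet> g) (at 0)" by (rule has_derivative_directional[OF deriv])
  have gap: "((\<lambda>h. b x - L * (\<bar>h\<bar> * norm g)) \<longlongrightarrow> b x - L * (\<bar>0\<bar> * norm g)) (at (0::real))" by (intro tendsto_intros)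
  then have "\<forall>\<^sub>F h in at (0::real). 0 < b x - L * (\<bar>h\<bar> * norm g)"
    using x by (intro order_tendstoD(1)) auto
  moreover have "\<forall>\<^sub>F h in at (0::real). h \<noteq> 0" by (simp add: eventually_neq_at_within)
  ultimately have ev: "\<forall>\<^sub>F h in at 0. (b x - L * (\<bar>h\<bar> * norm g)) * \<bar>?Q h\<bar> \<le> c * norm g"
  proof eventually_elim
    case (elim h)
    have "(b x - L * (\<bar>h\<bar> * norm g)) * \<bar>u (x + h *\<^sub>R g) - u x\<bar> \<le> c * (\<bar>h\<bar> * norm g)"
      using adm[unfolded admissible_def, rule_format, of x "x + h *\<^sub>R g"] elim by (simp add: dist_norm)
    then have "(b x - L * (\<bar>h\<bar> * norm g)) * \<bar>u (x + h *\<^sub>R g) - u x\<bar> / \<bar>h\<bar> \<le> c * norm g"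
      using elim by (simp add: pos_divide_le_eq mult_ac)
    then show ?case by (simp add: abs_divide)
  qed
  have "(b x - L * (\<bar>0\<bar> * norm g)) * \<bar>g \<bullet> g\<bar> \<le> c * norm g"
    by (rule tendsto_le[OF _ tendsto_const tendsto_mult[OF gap tendsto_rabs[OF Q]] ev]) simp
  then have "(b x * norm g) * norm g \<le> c * norm g"
    by (simp add: power2_norm_eq_inner[symmetric] power2_eq_square mult.assoc)
  then show ?thesis using False by simp
qed (use c in simp)

end

section \<open>The variational formula\<close>

lemma grad_eqI:
  assumes "(w has_derivative (\<lambda>h. h \<bullet> g)) (at y)"
  shows "grad w y = g"
  unfolding grad_def
proof (rule the_equality)
  show "GDERIV w y :> g" using assms by (simp add: gderiv_def)
  fix D assume "GDERIV w y :> D"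
  then have "(w has_derivative (\<lambda>h. h \<bullet> D)) (at y)" by (simp add: gderiv_def)
  from has_derivative_unique[OF this assms] have "h \<bullet> D = h \<bullet> g" for h by metis
  then show "D = g" by (metis vector_eq_ldot)
qed

lemma L_mu_eq_Lip:
  assumes "0 < \<mu>"
  shows "L_mu \<mu> f V = Lip"
proof -
  have "w \<in> S_mu \<mu> f V" if w: "w \<in> Lip" for w
  proof -
    obtain K where K: "K-lipschitz_on UNIV w" using w by (auto simp: Lip_def)
    then have K0: "0 \<le> K" by (rule lipschitz_on_nonneg)
    \<comment> \<open>Below \<open>k\<close> the Lipschitz constant satisfies
      \<open>K \<le> \<mu> / \<delta>\<close>. The summand 1 covers \<open>K = 0\<close>, and the
      minimum with \<open>\<eta>\<close> makes the thresholds tend to 0.\<close>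
    define k where "k = \<mu> / (K + 1)"
    have k: "k > 0" using K0 assms by (simp add: k_def add_nonneg_pos)
    have "((\<lambda>\<eta>. min \<eta> k) \<longlongrightarrow> min 0 k) (at_right 0)"
      by (intro tendsto_min tendsto_ident_at tendsto_const)
    then have 1: "((\<lambda>\<eta>. min \<eta> k) \<longlongrightarrow> 0) (at_right 0)" using k by simp
    have 2: "\<bar>w y1 - w y2\<bar> \<le> (\<mu> / \<delta> + \<eta>) * norm (y1 - y2)" if "0 < \<eta>" "0 < \<delta>" "\<delta> < min \<eta> k" for \<eta> \<delta> y1 y2
    proof -
      have "\<delta> * (K + 1) \<le> \<mu>" using that K0 by (simp add: k_def field_simps)
      then have "\<delta> * K \<le> \<mu>" using that by (simp add: distrib_left)
      then have "K \<le> \<mu> / \<delta>" using that by (simp add: field_simps)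
      then have "K * norm (y1 - y2) \<le> (\<mu> / \<delta> + \<eta>) * norm (y1 - y2)" using that by (intro mult_right_mono) auto
      then show ?thesis using lipschitz_onD[OF K, of y1 y2] by (simp add: dist_norm)
    qed
    show ?thesis
      unfolding S_mu_def using 1 2 k
      by (intro CollectI exI[of _ 1] conjI exI[of _ "\<lambda>\<eta>. min \<eta> k"]) auto
  qed
  then show ?thesis by (auto simp: L_mu_def)
qed

lemma Lip_add_inner:
  assumes "w \<in> Lip"
  shows "(\<lambda>y. w y + p \<bullet> y) \<in> Lip"
proof -
  obtain K where "K-lipschitz_on UNIV w" using assms by (auto simp: Lip_def)
  moreover have "(norm p)-lipschitz_on UNIV (\<lambda>y. p \<bullet> y)"
    by (intro lipschitz_onI) (simp_all add: dist_norm Cauchy_Schwarz_ineq2 flip: inner_diff_right)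
  ultimately show ?thesis unfolding Lip_def by (blast intro: lipschitz_on_add)
qed

lemma S_plus_iff: "w \<in> S_plus \<longleftrightarrow> w \<in> Lip \<and> above_plane 0 w"
proof -
  have "0 \<le> Liminf at_infinity (\<lambda>y. ereal (w y / norm y)) \<longleftrightarrow> above_plane 0 w"
  proof
    assume L: "0 \<le> Liminf at_infinity (\<lambda>y. ereal (w y / norm y))"
    show "above_plane 0 w"
      unfolding above_plane_def
    proof (intro allI impI)
      fix e :: real assume e: "e > 0"
      then have "\<forall>\<^sub>F y in at_infinity. ereal (- e) < ereal (w y / norm y)"
        by (intro L[unfolded le_Liminf_iff, rule_format]) simp
      then obtain R where R: "\<And>y. R \<le> norm y \<Longrightarrow> - e < w y / norm y"
        unfolding eventually_at_infinity by auto
      have "- e * norm y \<le> w y - 0 \<bullet> y" if "max R 1 \<le> norm y" for y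
      proof -
        have "norm y > 0" using that by linarith
        moreover have "- e < w y / norm y" using R that by simp
        ultimately show ?thesis by (simp add: pos_less_divide_eq)
      qed
      then show "\<exists>R. \<forall>y. R \<le> norm y \<longrightarrow> - e * norm y \<le> w y - 0 \<bullet> y" by blast
    qed
  next
    assume A: "above_plane 0 w"
    show "0 \<le> Liminf at_infinity (\<lambda>y. ereal (w y / norm y))"
      unfolding le_Liminf_iff
    proof (intro allI impI)
      fix s :: ereal assume s: "s < 0"
      obtain e where e: "e > 0" "s < ereal (- e)"
      proof -
        obtain r where "s < ereal r" "ereal r < 0" using ereal_dense2[OF s] by auto
        then show thesis by (intro that[of "- r"]) auto
      qed
      obtain R where R: "\<And>y. R \<le> norm y \<Longrightarrow> - e * norm y \<le> w y - 0 \<bullet> y"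
        using A e unfolding above_plane_def by blast
      have "s < ereal (w y / norm y)" if "max R 1 \<le> norm y" for y
      proof -
        have "norm y > 0" using that by linarith
        then have "- e \<le> w y / norm y" using R[of y] that by (simp add: pos_le_divide_eq)
        then show ?thesis using e(2) by (meson ereal_less_eq(3) order_less_le_trans)
      qed
      then show "\<forall>\<^sub>F y in at_infinity. s < ereal (w y / norm y)"
        unfolding eventually_at_infinity by blast
    qed
  qed
  then show ?thesis by (simp add: S_plus_def)
qed

lemma S_minus_iff: "w \<in> S_minus \<longleftrightarrow> (\<lambda>y. - w y) \<in> S_plus"
proof -
  have "(\<lambda>y. - w y) \<in> Lip" if "w \<in> Lip" for w :: "real^'n \<Rightarrow> real"
    using that lipschitz_on_minus unfolding Lip_def by blast
  from this this[of "\<lambda>y. - w y"] have 1: "w \<in> Lip \<longleftrightarrow> (\<lambda>y. - w y) \<in> Lip" by auto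
  have "Liminf at_infinity (\<lambda>y. ereal (- w y / norm y)) = - Limsup at_infinity (\<lambda>y. ereal (w y / norm y))"
    using ereal_Liminf_uminus[of at_infinity "\<lambda>y. ereal (w y / norm y)"] by simp
  then show ?thesis unfolding S_minus_def S_plus_def using 1 by (simp add: ereal_0_le_uminus_iff)
qed

lemma AE_grad:
  fixes w :: "real^'n \<Rightarrow> real"
  assumes "w \<in> Lip"
  obtains g where "g \<in> borel_measurable borel"
    "AE y in lborel. (w has_derivative (\<lambda>h. h \<bullet> g y)) (at y) \<and> grad w y = g y"
proof -
  obtain K where "K-lipschitz_on UNIV w" using assms by (auto simp: Lip_def)
  from Rademacher[OF this] obtain g where g: "g \<in> borel_measurable borel"
    "AE y in lborel. (w has_derivative (\<lambda>h. h \<bullet> g y)) (at y)" by blast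
  from g(2) have "AE y in lborel. (w has_derivative (\<lambda>h. h \<bullet> g y)) (at y) \<and> grad w y = g y"
    by eventually_elim (auto intro: grad_eqI)
  with g(1) show ?thesis by (rule that)
qed

text \<open>The definite description in \<open>grad\<close> does not show any measurability. But
  \<open>grad w\<close> agrees almost everywhere with a Borel function, and completeness of Lebesgue
  measure transfers measurability, which the upper bound on \<open>esssup\<close> asks for.\<close>

lemma measurable_speed_grad:
  fixes w f :: "real^'n \<Rightarrow> real"
  assumes "w \<in> Lip" and f: "continuous_on UNIV f"
  shows "(\<lambda>y. ereal (f y * norm (p + grad w y))) \<in> borel_measurable (lebesgue_on V)"
proof -
  have [measurable]: "f \<in> borel_measurable borel" by (rule borel_measurable_continuous_onI[OF f])
  obtain g where g[measurable]: "g \<in> borel_measurable borel"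
    and ae: "AE y in lborel. (w has_derivative (\<lambda>h. h \<bullet> g y)) (at y) \<and> grad w y = g y"
    using AE_grad[OF assms(1)] by blast
  have "(\<lambda>y. f y * norm (p + g y)) \<in> borel_measurable lborel" by measurable
  then have 1: "(\<lambda>y. f y * norm (p + g y)) \<in> borel_measurable lebesgue" by (rule measurable_completion)
  have "(\<lambda>y. f y * norm (p + grad w y)) \<in> borel_measurable lebesgue"
    by (rule borel_measurable_AE[OF 1]) (use AE_completion[OF ae] in \<open>eventually_elim, simp\<close>)
  then show ?thesis by (intro borel_measurable_ereal measurable_restrict_space1)
qed

section \<open>One component as a speed on the whole space\<close>

definition cutoff :: "('a \<Rightarrow> real) \<Rightarrow> 'a set \<Rightarrow> 'a \<Rightarrow> real" where
  "cutoff f V x = (if x \<in> V then f x else 0)"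

locale positive_component =
  fixes L :: real and f :: "real^'n \<Rightarrow> real" and V :: "(real^'n) set" and C :: real
  assumes lipschitz_f: "L-lipschitz_on UNIV f" and open_V: "open V" and V_nonempty: "V \<noteq> {}"
    and f_pos: "\<And>x. x \<in> V \<Longrightarrow> 0 < f x" and f_frontier: "\<And>x. x \<in> frontier V \<Longrightarrow> f x = 0"
    and f_bound: "\<And>x. f x \<le> C"
begin

sublocale speed L "cutoff f V" C
proof
  obtain x where x: "x \<in> V" using V_nonempty by blast
  then show "\<exists>x. 0 < cutoff f V x" using f_pos by (auto simp: cutoff_def)
  have "0 \<le> C" using f_pos[OF x] f_bound[of x] by linarith
  then show "cutoff f V x \<le> C" for x using f_bound by (simp add: cutoff_def)
  show "0 \<le> cutoff f V x" for x using f_pos by (simp add: cutoff_def less_imp_le)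
  have L: "0 \<le> L" using lipschitz_f by (rule lipschitz_on_nonneg)
  \<comment> \<open>A segment that leaves \<open>V\<close> meets the frontier, where
    \<open>f\<close> vanishes; so \<open>f x\<close> is at most \<open>L\<close> times the distance
    to the crossing point.\<close>
  have cross: "f x \<le> L * dist x y" if "x \<in> V" "y \<notin> V" for x y
  proof -
    have "closed_segment x y \<inter> V \<noteq> {}" using that(1) ends_in_segment(1) by blast
    moreover have "closed_segment x y - V \<noteq> {}" using that(2) ends_in_segment(2) by blast
    ultimately have "closed_segment x y \<inter> frontier V \<noteq> {}"
      using connected_Int_frontier[OF connected_segment(1)] by blast
    then obtain z where z: "z \<in> closed_segment x y" "z \<in> frontier V" by blast
    have "f x \<le> L * dist x z"
      using lipschitz_onD[OF lipschitz_f, of x z] f_frontier[OF z(2)] by (simp add: dist_real_def)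
    also have "\<dots> \<le> L * dist x y"
      using segment_bound(1)[OF z(1)] L by (intro mult_left_mono) (simp_all add: dist_norm norm_minus_commute)
    finally show ?thesis .
  qed
  show "L-lipschitz_on UNIV (cutoff f V)"
  proof (rule lipschitz_onI[OF _ L])
    fix x y
    consider "x \<in> V" "y \<in> V" | "x \<in> V" "y \<notin> V" | "x \<notin> V" "y \<in> V" | "x \<notin> V" "y \<notin> V" by blast
    then show "dist (cutoff f V x) (cutoff f V y) \<le> L * dist x y"
    proof cases
      case 1
      then show ?thesis using lipschitz_onD[OF lipschitz_f, of x y] by (simp add: cutoff_def)
    next
      case 2
      then show ?thesis using cross[OF 2] f_pos[of x] by (simp add: cutoff_def dist_real_def)
    next
      case 3
      then show ?thesis using cross[OF 3(2,1)] f_pos[of y] by (simp add: cutoff_def dist_real_def dist_commute)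
    next
      case 4
      then show ?thesis using L by (simp add: cutoff_def)
    qed
  qed
qed

lemma ham_le_esssup:
  assumes w: "w \<in> S_plus"
  shows "ereal (ham L (cutoff f V) p) \<le> esssup (lebesgue_on V) (\<lambda>y. ereal (f y * norm (p + grad w y)))"
\<comment> \<open>Testing real upper bounds \<open>c\<close> also covers an infinite essential
  supremum.\<close>
proof (rule ereal_le_real)
  fix c :: real
  assume le: "esssup (lebesgue_on V) (\<lambda>y. ereal (f y * norm (p + grad w y))) \<le> ereal c"
  have wL: "w \<in> Lip" and above: "above_plane 0 w" using w by (auto simp: S_plus_iff)
  have V: "V \<in> sets lebesgue" using open_V by (simp add: lebesgue_openin)
  have "AE y in lebesgue_on V. f y * norm (p + grad w y) \<le> c"
    using esssup_AE[of "\<lambda>y. ereal (f y * norm (p + grad w y))" "lebesgue_on V"]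
  proof eventually_elim
    case (elim y)
    from order_trans[OF elim le] show ?case by simp
  qed
  then have "AE y in lebesgue. y \<in> V \<longrightarrow> f y * norm (p + grad w y) \<le> c"
    using V by (simp add: AE_restrict_space_iff)
  then have ae: "AE y in lborel. y \<in> V \<longrightarrow> f y * norm (p + grad w y) \<le> c"
    by (simp add: AE_completion_iff)
  \<comment> \<open>Outside \<open>V\<close> the bound for the cutoff speed reads
    \<open>0 \<le> c\<close>. A negative \<open>c\<close> would force the nonempty open set
    \<open>V\<close> to be null.\<close>
  have c: "0 \<le> c"
  proof (rule ccontr)
    assume "\<not> 0 \<le> c"
    have "AE y in lborel. y \<notin> V"
      using ae
    proof eventually_elim
      case (elim y)
      show ?case
      proof
        assume "y \<in> V"
        then have "0 \<le> f y * norm (p + grad w y)" using f_pos[of y] by simp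
        with elim \<open>y \<in> V\<close> \<open>\<not> 0 \<le> c\<close> show False by linarith
      qed
    qed
    then have "AE y in lebesgue. y \<notin> V" by (rule AE_completion)
    then have "negligible V"
      using V by (simp add: negligible_iff_null_sets AE_iff_null_sets)
    then show False using open_not_negligible[OF open_V V_nonempty] by blast
  qed
  obtain g where g[measurable]: "g \<in> borel_measurable borel"
    and deriv: "AE y in lborel. (w has_derivative (\<lambda>h. h \<bullet> g y)) (at y) \<and> grad w y = g y"
    using AE_grad[OF wL] by blast
  let ?u = "\<lambda>y. w y + p \<bullet> y"
  obtain K where K: "K-lipschitz_on UNIV ?u" using Lip_add_inner[OF wL, of p] by (auto simp: Lip_def)
  have "admissible L (cutoff f V) c ?u"
  proof (rule admissible_if_gradient_bound[OF K])
    show "(\<lambda>y. g y + p) \<in> borel_measurable borel" by measurable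
    show "AE y in lborel. (?u has_derivative (\<lambda>h. h \<bullet> (g y + p))) (at y)"
      using deriv
    proof eventually_elim
      case (elim y)
      then have "(?u has_derivative (\<lambda>h. h \<bullet> g y + p \<bullet> h)) (at y)"
        by (intro has_derivative_add has_derivative_inner_right has_derivative_ident) simp
      then show ?case by (simp add: inner_add_right inner_commute)
    qed
    show "AE y in lborel. cutoff f V y * norm (g y + p) \<le> c"
      using ae deriv by eventually_elim (use c in \<open>auto simp: cutoff_def add.commute\<close>)
  qed
  moreover have "above_plane p ?u" using above by (simp add: above_plane_def)
  ultimately have "attains L (cutoff f V) p c" using K unfolding attains_def by blast
  then show "ereal (ham L (cutoff f V) p) \<le> ereal c" using ham_le by simp
qed

lemma esssup_le_if_attains:
  assumes "attains L (cutoff f V) p c"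
  obtains w where "w \<in> S_plus"
    "esssup (lebesgue_on V) (\<lambda>y. ereal (f y * norm (p + grad w y))) \<le> ereal c"
proof -
  obtain u K where u: "K-lipschitz_on UNIV u" "admissible L (cutoff f V) c u" "above_plane p u"
    using assms unfolding attains_def by blast
  have c: "0 \<le> c" by (rule attains_nonneg[OF assms])
  define w where "w y = u y + (- p) \<bullet> y" for y
  have uL: "u \<in> Lip" using u(1) by (auto simp: Lip_def)
  have wL: "w \<in> Lip" using Lip_add_inner[OF uL, of "- p"] by (simp add: w_def[abs_def])
  have w: "w \<in> S_plus" unfolding S_plus_iff using wL u(3) by (simp add: above_plane_def w_def)
  have V: "V \<in> sets lebesgue" using open_V by (simp add: lebesgue_openin)
  obtain g where deriv: "AE y in lborel. (u has_derivative (\<lambda>h. h \<bullet> g y)) (at y) \<and> grad u y = g y"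
    using AE_grad[OF uL] by blast
  have "AE y in lborel. y \<in> V \<longrightarrow> ereal (f y * norm (p + grad w y)) \<le> ereal c"
    using deriv
  proof (eventually_elim, intro impI)
    fix y assume d: "(u has_derivative (\<lambda>h. h \<bullet> g y)) (at y) \<and> grad u y = g y" and y: "y \<in> V"
    then have "(w has_derivative (\<lambda>h. h \<bullet> g y + (- p) \<bullet> h)) (at y)"
      unfolding w_def[abs_def] by (intro has_derivative_add has_derivative_inner_right has_derivative_ident) simp
    then have "(w has_derivative (\<lambda>h. h \<bullet> (g y - p))) (at y)"
      by (simp add: inner_diff_right inner_commute)
    then have "p + grad w y = g y" by (simp add: grad_eqI)
    moreover have "cutoff f V y * norm (g y) \<le> c"
      using d y f_pos[OF y] by (intro gradient_bound_if_admissible[OF u(2) c]) (auto simp: cutoff_def)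
    ultimately show "ereal (f y * norm (p + grad w y)) \<le> ereal c" using y by (simp add: cutoff_def)
  qed
  from AE_completion[OF this] have "AE y in lebesgue_on V. ereal (f y * norm (p + grad w y)) \<le> ereal c"
    using V by (simp add: AE_restrict_space_iff)
  then have "esssup (lebesgue_on V) (\<lambda>y. ereal (f y * norm (p + grad w y))) \<le> ereal c"
    by (intro esssup_I measurable_speed_grad[OF wL] lipschitz_on_continuous_on[OF lipschitz_f])
  with w show ?thesis by (rule that)
qed

lemma ham_eq_Inf_esssup:
  "ereal (ham L (cutoff f V) p) =
    (INF w\<in>S_plus. esssup (lebesgue_on V) (\<lambda>y. ereal (f y * norm (p + grad w y))))"
proof (rule antisym)
  show "ereal (ham L (cutoff f V) p) \<le> (INF w\<in>S_plus. esssup (lebesgue_on V) (\<lambda>y. ereal (f y * norm (p + grad w y))))"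
    by (intro INF_greatest ham_le_esssup)
  show "(INF w\<in>S_plus. esssup (lebesgue_on V) (\<lambda>y. ereal (f y * norm (p + grad w y)))) \<le> ereal (ham L (cutoff f V) p)"
    (is "?I \<le> _")
  proof (rule ccontr)
    assume "\<not> ?thesis"
    then have "ereal (ham L (cutoff f V) p) < ?I" by simp
    from ereal_dense2[OF this] obtain r where r: "ham L (cutoff f V) p < r" "ereal r < ?I" by auto
    then obtain d where d: "d < r" "attains L (cutoff f V) p d" using ham_less_iff by blast
    obtain w where w: "w \<in> S_plus" "esssup (lebesgue_on V) (\<lambda>y. ereal (f y * norm (p + grad w y))) \<le> ereal d"
      using esssup_le_if_attains[OF d(2)] by blast
    have "?I \<le> esssup (lebesgue_on V) (\<lambda>y. ereal (f y * norm (p + grad w y)))"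
      using w(1) by (rule INF_lower)
    then have "?I \<le> ereal d" using w(2) by (rule order_trans)
    then have "?I < ereal r" using d(1) by (simp add: order_le_less_trans)
    then show False using r(2) by simp
  qed
qed

end

lemma essinf_eq_uminus_esssup:
  fixes w f :: "real^'n \<Rightarrow> real"
  assumes w: "w \<in> Lip" and f: "continuous_on UNIV f" and V: "V \<in> sets lebesgue"
  shows "essinf (lebesgue_on V) (\<lambda>y. ereal (f y * norm (p + grad w y)))
    = - esssup (lebesgue_on V) (\<lambda>y. ereal (- f y * norm (- p + grad (\<lambda>y. - w y) y)))"
proof -
  have w': "(\<lambda>y. - w y) \<in> Lip" using w lipschitz_on_minus unfolding Lip_def by blast
  have f': "continuous_on UNIV (\<lambda>y. - f y)" using f by (rule continuous_on_minus)
  obtain g where "AE y in lborel. (w has_derivative (\<lambda>h. h \<bullet> g y)) (at y) \<and> grad w y = g y"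
    using AE_grad[OF w] by blast
  \<comment> \<open>Only almost everywhere: where \<open>w\<close> is not differentiable, the
    unspecified values of \<open>grad\<close> need not be opposite.\<close>
  then have "AE y in lborel. grad (\<lambda>y. - w y) y = - grad w y"
  proof eventually_elim
    case (elim y)
    then have "((\<lambda>y. - w y) has_derivative (\<lambda>h. - (h \<bullet> g y))) (at y)"
      by (intro has_derivative_minus) simp
    then have "((\<lambda>y. - w y) has_derivative (\<lambda>h. h \<bullet> (- g y))) (at y)" by simp
    then have "grad (\<lambda>y. - w y) y = - g y" by (rule grad_eqI)
    then show ?case using elim by simp
  qed
  then have "AE y in lborel. - ereal (f y * norm (p + grad w y)) = ereal (- f y * norm (- p + grad (\<lambda>y. - w y) y))"
  proof eventually_elim
    case (elim y)
    have "norm (- p - grad w y) = norm (p + grad w y)"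
      using norm_minus_cancel[of "p + grad w y"] by (simp add: algebra_simps)
    then show ?case using elim by simp
  qed
  from AE_completion[OF this]
  have "AE y in lebesgue. y \<in> V \<longrightarrow> - ereal (f y * norm (p + grad w y)) = ereal (- f y * norm (- p + grad (\<lambda>y. - w y) y))"
    by eventually_elim simp
  then have "AE y in lebesgue_on V. - ereal (f y * norm (p + grad w y)) = ereal (- f y * norm (- p + grad (\<lambda>y. - w y) y))"
    using V by (subst AE_restrict_space_iff) auto
  then have "esssup (lebesgue_on V) (\<lambda>y. - ereal (f y * norm (p + grad w y)))
      = esssup (lebesgue_on V) (\<lambda>y. ereal (- f y * norm (- p + grad (\<lambda>y. - w y) y)))"
    using measurable_speed_grad[OF w f, of p V] measurable_speed_grad[OF w' f', of "- p" V]
    by (intro esssup_AE_cong borel_measurable_uminus_ereal)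
  then show ?thesis by (simp add: essinf_def)
qed

section \<open>Ergodicity\<close>

lemma measurable_chain_cost:
  assumes b[measurable]: "\<And>x. (\<lambda>\<omega>. b \<omega> x) \<in> borel_measurable M"
  shows "(\<lambda>\<omega>. chain_cost (step_cost L (b \<omega>) K c) x xs) \<in> borel_measurable M"
proof (induction xs arbitrary: x)
  case (Cons y ys)
  have "(\<lambda>\<omega>. step_cost L (b \<omega>) K c x y) \<in> borel_measurable M"
    unfolding step_cost_def by measurable
  then show ?case using Cons.IH[of y] by simp
qed simp

text \<open>A chain cost depends on finitely many values of \<open>b \<omega>\<close>, so each
  single comparison is an event. The quantifiers around it range over naturals, rationals,
  \<open>D\<close> and finite lists in \<open>D\<close>, all countable.\<close>

lemma sets_ham_less:
  fixes b :: "'w \<Rightarrow> 'a::euclidean_space \<Rightarrow> real"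
  assumes speed: "\<And>\<omega>. \<omega> \<in> space M \<Longrightarrow> speed L (b \<omega>) C"
    and meas: "\<And>x. (\<lambda>\<omega>. b \<omega> x) \<in> borel_measurable M"
  shows "{\<omega>\<in>space M. ham L (b \<omega>) p < s} \<in> sets M"
proof -
  obtain D :: "'a set" where D: "countable D" "\<And>X. open X \<Longrightarrow> X \<noteq> {} \<Longrightarrow> \<exists>x\<in>D. x \<in> X"
    using countable_dense_setE by blast
  then have dense: "dense_set D" by unfold_locales
  have [measurable]: "(\<lambda>\<omega>. chain_cost (step_cost L (b \<omega>) K c) x xs) \<in> borel_measurable M" for K c x xs
    by (rule measurable_chain_cost[OF meas])
  have "{\<omega>\<in>space M. chain_above L (b \<omega>) D K c p} \<in> sets M" for K c
    unfolding chain_above_def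
    by (intro sets.sets_Collect_countable_All sets.sets_Collect_countable_Ex
        sets.sets_Collect_countable_All' D(1) countable_lists sets.sets_Collect_imp sets.sets_Collect_const) measurable
  then have "{\<omega>\<in>space M. \<exists>d\<in>\<rat>. 0 \<le> d \<and> d < s \<and> (\<exists>K::nat. chain_above L (b \<omega>) D (real K) d p)} \<in> sets M"
    by (intro sets.sets_Collect_countable_Ex' sets.sets_Collect_conj sets.sets_Collect_countable_Ex
        countable_rat sets.sets_Collect_const)
  also have "{\<omega>\<in>space M. \<exists>d\<in>\<rat>. 0 \<le> d \<and> d < s \<and> (\<exists>K::nat. chain_above L (b \<omega>) D (real K) d p)}
      = {\<omega>\<in>space M. ham L (b \<omega>) p < s}"
  proof (intro Collect_cong conj_cong refl)
    fix \<omega> assume \<omega>: "\<omega> \<in> space M"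
    interpret speed L "b \<omega>" C by (rule speed[OF \<omega>])
    have "continuous_on UNIV (b \<omega>)" by (rule lipschitz_on_continuous_on[OF lipschitz])
    then show "(\<exists>d\<in>\<rat>. 0 \<le> d \<and> d < s \<and> (\<exists>K::nat. chain_above L (b \<omega>) D (real K) d p)) = (ham L (b \<omega>) p < s)"
      unfolding ham_less_iff using attains_iff_chain_above[OF dense] by blast
  qed
  finally show ?thesis .
qed

context ergodic_group
begin

lemma invariant_zero_one:
  assumes Q: "{\<omega>\<in>space M. Q \<omega>} \<in> sets M"
    and inv: "\<And>z \<omega>. \<omega> \<in> space M \<Longrightarrow> Q (\<tau> z \<omega>) \<longleftrightarrow> Q \<omega>"
  shows "(AE \<omega> in M. Q \<omega>) \<or> (AE \<omega> in M. \<not> Q \<omega>)"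
proof -
  let ?A = "{\<omega>\<in>space M. Q \<omega>}"
  have "\<tau> z ` ?A = ?A" for z
  proof (intro equalityI subsetI)
    fix \<omega> assume \<omega>: "\<omega> \<in> ?A"
    then have "\<omega> = \<tau> z (\<tau> (- z) \<omega>)" using add[of \<omega> z "- z"] zero by simp
    moreover have "\<tau> (- z) \<omega> \<in> ?A" using \<omega> maps_to inv by simp
    ultimately show "\<omega> \<in> \<tau> z ` ?A" by blast
  qed (use maps_to inv in auto)
  with ergodic[OF Q] have "prob ?A = 0 \<or> prob ?A = 1" by blast
  then show ?thesis
    using Q prob_Collect_eq_1[of Q] prob_Collect_eq_0[of Q] by blast
qed

text \<open>\<open>T\<close> records the strict inequalities that hold almost surely. For countably
  many pairs they are decided simultaneously off one null set, so a single realization outside it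
  determines the values at dense \<open>p\<close>, and continuity determines the others.\<close>

lemma ham_deterministic:
  fixes b :: "'w \<Rightarrow> real^'n \<Rightarrow> real"
  assumes speed: "\<And>\<omega>. \<omega> \<in> space M \<Longrightarrow> speed L (b \<omega>) C"
    and meas: "\<And>x. (\<lambda>\<omega>. b \<omega> x) \<in> borel_measurable M"
    and stat: "\<And>\<omega> x z. \<omega> \<in> space M \<Longrightarrow> b (\<tau> z \<omega>) x = b \<omega> (x + z)"
  obtains \<omega>0 where "\<omega>0 \<in> space M" "AE \<omega> in M. ham L (b \<omega>) = ham L (b \<omega>0)"
proof -
  obtain D :: "(real^'n) set" where D: "countable D" "\<And>X. open X \<Longrightarrow> X \<noteq> {} \<Longrightarrow> \<exists>x\<in>D. x \<in> X"
    using countable_dense_setE by blast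
  then interpret dense_set D by unfold_locales
  define T where "T = {(p, s). AE \<omega> in M. ham L (b \<omega>) p < s}"
  have dichotomy: "AE \<omega> in M. (ham L (b \<omega>) p < s) = ((p, s) \<in> T)" for p s
  proof -
    have "b (\<tau> z \<omega>) = (\<lambda>x. b \<omega> (x + z))" if "\<omega> \<in> space M" for \<omega> z
      using stat[OF that] by blast
    then have "(AE \<omega> in M. ham L (b \<omega>) p < s) \<or> (AE \<omega> in M. \<not> ham L (b \<omega>) p < s)"
      by (intro invariant_zero_one sets_ham_less[OF speed meas]) (simp_all add: ham_translate)
    then show ?thesis
    proof
      assume A: "AE \<omega> in M. \<not> ham L (b \<omega>) p < s"
      have "(p, s) \<notin> T"
      proof
        assume "(p, s) \<in> T"
        then have "AE \<omega> in M. ham L (b \<omega>) p < s" by (simp add: T_def)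
        with A have "AE \<omega> in M. False" by eventually_elim simp
        then show False by simp
      qed
      then show ?thesis using A by simp
    next
      assume A: "AE \<omega> in M. ham L (b \<omega>) p < s"
      then show ?thesis by (simp add: T_def)
    qed
  qed
  have ae: "AE \<omega> in M. \<forall>p\<in>D. \<forall>s\<in>\<rat>. ham L (b \<omega>) p < s \<longleftrightarrow> (p, s) \<in> T"
    by (intro AE_ball_countable[THEN iffD2] D(1) countable_rat ballI dichotomy)
  have "\<exists>\<omega>0. \<omega>0 \<in> space M \<and> (\<forall>p\<in>D. \<forall>s\<in>\<rat>. ham L (b \<omega>0) p < s \<longleftrightarrow> (p, s) \<in> T)"
  proof (rule ccontr)
    assume "\<not> ?thesis"
    then have "AE \<omega> in M. \<not> (\<forall>p\<in>D. \<forall>s\<in>\<rat>. ham L (b \<omega>) p < s \<longleftrightarrow> (p, s) \<in> T)"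
      by (intro AE_I2) blast
    with ae have "AE \<omega> in M. False" by eventually_elim blast
    then show False by simp
  qed
  then obtain \<omega>0 where \<omega>0: "\<omega>0 \<in> space M" "\<And>p s. p \<in> D \<Longrightarrow> s \<in> \<rat> \<Longrightarrow> ham L (b \<omega>0) p < s \<longleftrightarrow> (p, s) \<in> T"
    by blast
  have "AE \<omega> in M. ham L (b \<omega>) = ham L (b \<omega>0)"
    using ae AE_space
  proof eventually_elim
    case (elim \<omega>)
    have eqD: "ham L (b \<omega>) p = ham L (b \<omega>0) p" if p: "p \<in> D" for p
    proof (rule ccontr)
      assume "ham L (b \<omega>) p \<noteq> ham L (b \<omega>0) p"
      then consider "ham L (b \<omega>) p < ham L (b \<omega>0) p" | "ham L (b \<omega>0) p < ham L (b \<omega>) p" by linarith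
      then show False
      proof cases
        case 1
        then obtain s where "s \<in> \<rat>" "ham L (b \<omega>) p < s" "s < ham L (b \<omega>0) p" using Rats_dense_in_real by blast
        then show False using elim \<omega>0(2) p by (meson less_asym)
      next
        case 2
        then obtain s where "s \<in> \<rat>" "ham L (b \<omega>0) p < s" "s < ham L (b \<omega>) p" using Rats_dense_in_real by blast
        then show False using elim \<omega>0(2) p by (meson less_asym)
      qed
    qed
    have cont: "isCont (ham L (b \<omega>)) p" if "\<omega> \<in> space M" for \<omega> p
      using lipschitz_on_continuous_on[OF speed.lipschitz_ham[OF speed[OF that]]]
      by (simp add: continuous_on_eq_continuous_at)
    show ?case
    proof
      fix p
      obtain X where X: "\<And>n. X n \<in> D" "X \<longlonglongrightarrow> p" using approx by blast
      have "(\<lambda>n. ham L (b \<omega>) (X n)) \<longlonglongrightarrow> ham L (b \<omega>) p"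
        by (rule isCont_tendsto_compose[OF cont[OF elim(2)] X(2)])
      moreover have "(\<lambda>n. ham L (b \<omega>) (X n)) \<longlonglongrightarrow> ham L (b \<omega>0) p"
        using isCont_tendsto_compose[OF cont[OF \<omega>0(1)] X(2)] by (simp add: eqD[OF X(1)])
      ultimately show "ham L (b \<omega>) p = ham L (b \<omega>0) p" by (rule LIMSEQ_unique)
    qed
  qed
  with \<omega>0(1) show ?thesis by (rule that)
qed

end

section \<open>Measurability and zero-one laws for the components\<close>

context component_medium
begin

text \<open>The group law turns the preimage of \<open>\<U> i\<close> under \<open>\<tau> x\<close>
  into an image under \<open>\<tau> (- x)\<close>, and images of events are events by
  \<open>sets_image\<close>.\<close>

lemma sets_hits:
  assumes "i \<in> Ip \<union> Im"
  shows "{\<omega>\<in>space M. x \<in> U i \<omega>} \<in> sets M"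
proof -
  have i: "i \<in> insert 0 (Ip \<union> Im)" using assms by blast
  have "{\<omega>\<in>space M. x \<in> U i \<omega>} = \<tau> (- x) ` \<U> i"
  proof (intro equalityI subsetI)
    fix \<omega> assume "\<omega> \<in> {\<omega>\<in>space M. x \<in> U i \<omega>}"
    then have "\<omega> \<in> space M" "\<tau> x \<omega> \<in> \<U> i" using U_stationary[OF i] by auto
    moreover from this(1) have "\<omega> = \<tau> (- x) (\<tau> x \<omega>)" using add[of \<omega> "- x" x] zero by simp
    ultimately show "\<omega> \<in> \<tau> (- x) ` \<U> i" by blast
  next
    fix \<omega> assume "\<omega> \<in> \<tau> (- x) ` \<U> i"
    then obtain \<omega>' where \<omega>': "\<omega>' \<in> \<U> i" "\<omega> = \<tau> (- x) \<omega>'" by blast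
    have s: "\<omega>' \<in> space M" using sets.sets_into_space[OF sets_\<U>[OF i]] \<omega>'(1) by blast
    have "\<tau> x \<omega> = \<omega>'" using add[OF s, of x "- x"] zero[OF s] \<omega>'(2) by simp
    then show "\<omega> \<in> {\<omega>\<in>space M. x \<in> U i \<omega>}"
      using \<omega>' maps_to[OF s] U_stationary[OF i] by auto
  qed
  then show ?thesis using sets_image[OF sets_\<U>[OF i]] by simp
qed

lemma mem_U_translate:
  assumes "i \<in> Ip \<union> Im" "\<omega> \<in> space M"
  shows "x \<in> U i (\<tau> z \<omega>) \<longleftrightarrow> x + z \<in> U i \<omega>"
  using assms U_stationary[of i \<omega>] U_stationary[of i "\<tau> z \<omega>"] maps_to add by simp

lemma component:
  assumes "\<omega> \<in> space M"
  shows "i \<in> Ip \<Longrightarrow> U i \<omega> \<in> components {x. 0 < a x \<omega>}"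
    and "i \<in> Im \<Longrightarrow> U i \<omega> \<in> components {x. a x \<omega> < 0}"
  using pos_components[OF assms] neg_components[OF assms] by (auto simp: bij_betw_def)

lemma continuous_a:
  assumes "\<omega> \<in> space M"
  shows "continuous_on UNIV (\<lambda>y. a y \<omega>)"
  by (rule lipschitz_on_continuous_on[OF equi_lipschitz[OF assms]])

lemma open_U:
  assumes "i \<in> Ip \<union> Im" "\<omega> \<in> space M"
  shows "open (U i \<omega>)"
proof -
  have "open {x. 0 < a x \<omega>}" "open {x. a x \<omega> < 0}"
    using continuous_a[OF assms(2)] by (intro open_Collect_less continuous_on_const; simp)+
  then show ?thesis using assms component[OF assms(2)] open_components by blast
qed

text \<open>Boundedness of an open set can be read off from its points in a countable dense set,
  hence is an event; \<open>\<tau> z\<close> moves the component rigidly.\<close>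

lemma bounded_zero_one:
  assumes i: "i \<in> Ip \<union> Im"
  shows "(AE \<omega> in M. bounded (U i \<omega>)) \<or> (AE \<omega> in M. \<not> bounded (U i \<omega>))"
proof (rule invariant_zero_one)
  obtain D :: "(real^'n) set" where D: "countable D" "\<And>X. open X \<Longrightarrow> X \<noteq> {} \<Longrightarrow> \<exists>x\<in>D. x \<in> X"
    using countable_dense_setE by blast
  have eq: "bounded V \<longleftrightarrow> (\<exists>N::nat. \<forall>x\<in>D. real N < norm x \<longrightarrow> x \<notin> V)" if "open V" for V :: "(real^'n) set"
  proof
    assume "bounded V"
    then obtain B where B: "\<And>x. x \<in> V \<Longrightarrow> norm x \<le> B" by (auto simp: bounded_iff)
    obtain N :: nat where "B \<le> real N" using real_arch_simple by blast
    with B show "\<exists>N::nat. \<forall>x\<in>D. real N < norm x \<longrightarrow> x \<notin> V"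
      by (intro exI[of _ N]) fastforce
  next
    assume "\<exists>N::nat. \<forall>x\<in>D. real N < norm x \<longrightarrow> x \<notin> V"
    then obtain N :: nat where N: "\<And>x. x \<in> D \<Longrightarrow> real N < norm x \<Longrightarrow> x \<notin> V" by blast
    have "V \<inter> - cball 0 (real N) = {}"
    proof (rule ccontr)
      assume "V \<inter> - cball 0 (real N) \<noteq> {}"
      moreover have "open (V \<inter> - cball 0 (real N))" using that by (intro open_Int open_Compl) auto
      ultimately obtain x where "x \<in> D" "x \<in> V \<inter> - cball 0 (real N)" using D(2) by blast
      then show False using N by auto
    qed
    then show "bounded V" using bounded_subset[OF bounded_cball, of V 0 "real N"] by blast
  qed
  have "{\<omega>\<in>space M. \<exists>N::nat. \<forall>x\<in>D. real N < norm x \<longrightarrow> x \<notin> U i \<omega>} \<in> sets M"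
    by (intro sets.sets_Collect_countable_Ex sets.sets_Collect_countable_All' D(1)
        sets.sets_Collect_imp sets.sets_Collect_neg sets.sets_Collect_const sets_hits[OF i])
  also have "{\<omega>\<in>space M. \<exists>N::nat. \<forall>x\<in>D. real N < norm x \<longrightarrow> x \<notin> U i \<omega>} = {\<omega>\<in>space M. bounded (U i \<omega>)}"
    using eq open_U[OF i] by blast
  finally show "{\<omega>\<in>space M. bounded (U i \<omega>)} \<in> sets M" .
  have translate: "bounded (U i (\<tau> z \<omega>))" if \<omega>: "\<omega> \<in> space M" and "bounded (U i \<omega>)" for z \<omega>
  proof -
    have "x = - z + (x + z)" for x :: "real^'n" by simp
    then have "U i (\<tau> z \<omega>) \<subseteq> (\<lambda>x. - z + x) ` U i \<omega>"
      using mem_U_translate[OF i \<omega>] by blast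
    then show ?thesis using bounded_translation[OF that(2)] bounded_subset by blast
  qed
  fix z \<omega> assume \<omega>: "\<omega> \<in> space M"
  have "\<tau> (- z) (\<tau> z \<omega>) = \<omega>" using add[OF \<omega>, of "- z" z] zero[OF \<omega>] by simp
  then show "bounded (U i (\<tau> z \<omega>)) \<longleftrightarrow> bounded (U i \<omega>)"
    using translate[OF \<omega>, of z] translate[OF maps_to[OF \<omega>, of z], of "- z"] by auto
qed

lemma measurable_a_section: "(\<lambda>\<omega>. a x \<omega>) \<in> borel_measurable M"
  using measurable_compose[OF measurable_Pair1' measurable_a, of x] by simp

text \<open>The factor \<open>s\<close> will be the sign of the component, so that positive and
  negative components are treated at once.\<close>

lemma deterministic_cutoff:
  assumes i: "i \<in> Ip \<union> Im"
    and pc: "\<And>\<omega>. \<omega> \<in> space M \<Longrightarrow> positive_component L (\<lambda>y. s * a y \<omega>) (U i \<omega>) C"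
  obtains \<omega>0 where "\<omega>0 \<in> space M"
    "AE \<omega> in M. ham L (cutoff (\<lambda>y. s * a y \<omega>) (U i \<omega>)) = ham L (cutoff (\<lambda>y. s * a y \<omega>0) (U i \<omega>0))"
proof (rule ham_deterministic)
  show "speed L (cutoff (\<lambda>y. s * a y \<omega>) (U i \<omega>)) C" if "\<omega> \<in> space M" for \<omega>
  proof -
    interpret positive_component L "\<lambda>y. s * a y \<omega>" "U i \<omega>" C by (rule pc[OF that])
    show ?thesis by unfold_locales
  qed
  show "(\<lambda>\<omega>. cutoff (\<lambda>y. s * a y \<omega>) (U i \<omega>) x) \<in> borel_measurable M" for x
    unfolding cutoff_def using sets_hits[OF i, of x] measurable_a_section[of x]
    by (intro measurable_If borel_measurable_times) auto
  show "cutoff (\<lambda>y. s * a y (\<tau> z \<omega>)) (U i (\<tau> z \<omega>)) x = cutoff (\<lambda>y. s * a y \<omega>) (U i \<omega>) (x + z)"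
    if "\<omega> \<in> space M" for \<omega> x z
    using mem_U_translate[OF i that] stationary[OF that] by (simp add: cutoff_def)
qed (rule that)

end

section \<open>Removal of the class parameter and passage to negative components\<close>

lemma image_S_class_eq:
  assumes "X \<subseteq> Lip"
  shows "{F w | w lam. w \<in> X \<and> lam > 0 \<and> (\<lambda>y. w y + p \<bullet> y) \<in> L_mu lam f V} = F ` X"
proof -
  \<comment> \<open>By \<open>L_mu_eq_Lip\<close> any positive parameter is a witness; 1 is
    taken.\<close>
  have "(\<lambda>y. w y + p \<bullet> y) \<in> L_mu 1 f V" if "w \<in> X" for w
    using assms that by (simp add: L_mu_eq_Lip Lip_add_inner subset_iff)
  then show ?thesis using zero_less_one by blast
qed

lemma S_plus_subset_Lip: "S_plus \<subseteq> Lip"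
  by (auto simp: S_plus_def)

lemma S_minus_subset_Lip: "S_minus \<subseteq> Lip"
  by (auto simp: S_minus_def)

text \<open>Negation exchanges \<open>S_minus\<close> with \<open>S_plus\<close> and suprema with
  infima. The vector \<open>p\<close> changes sign too, because the whole gradient
  \<open>p + grad w y\<close> is negated.\<close>

lemma uminus_ham_eq_Sup_essinf:
  assumes "positive_component L (\<lambda>y. - f y) V C"
  shows "ereal (- ham L (cutoff (\<lambda>y. - f y) V) (- p)) =
    (SUP w\<in>S_minus. essinf (lebesgue_on V) (\<lambda>y. ereal (f y * norm (p + grad w y))))"
proof -
  interpret positive_component L "\<lambda>y. - f y" V C by fact
  have f: "continuous_on UNIV f"
    using continuous_on_minus[OF lipschitz_on_continuous_on[OF lipschitz_f]] by simp
  have V: "V \<in> sets lebesgue" using open_V by (simp add: lebesgue_openin)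
  let ?E = "\<lambda>w. esssup (lebesgue_on V) (\<lambda>y. ereal (- f y * norm (- p + grad w y)))"
  let ?m = "\<lambda>w y. - w y :: real"
  have S: "S_plus = ?m ` S_minus"
  proof (intro equalityI subsetI)
    fix w assume w: "w \<in> S_plus"
    then have "?m w \<in> S_minus" by (simp add: S_minus_iff)
    then show "w \<in> ?m ` S_minus" by (rule rev_image_eqI) simp
  qed (auto simp: S_minus_iff)
  have "ereal (- ham L (cutoff (\<lambda>y. - f y) V) (- p)) = - (INF w\<in>S_plus. ?E w)"
    using ham_eq_Inf_esssup[of "- p"] by (simp flip: uminus_ereal.simps(1))
  also have "\<dots> = - (INF w\<in>S_minus. ?E (?m w))" by (simp add: S image_image)
  also have "\<dots> = (SUP w\<in>S_minus. - ?E (?m w))" by (rule ereal_SUP_uminus_eq[symmetric])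
  also have "\<dots> = (SUP w\<in>S_minus. essinf (lebesgue_on V) (\<lambda>y. ereal (f y * norm (p + grad w y))))"
    by (intro SUP_cong refl essinf_eq_uminus_esssup[OF _ f V, symmetric]) (simp add: S_minus_def)
  finally show ?thesis .
qed

context component_medium
begin

text \<open>A point of a common component would carry both signs. So for a given index only one of
  the two unbounded clauses of the theorem has content, and \<open>H\<close> may be chosen for that
  one.\<close>

lemma disjoint_indices: "Ip \<inter> Im = {}"
proof (rule ccontr)
  assume "Ip \<inter> Im \<noteq> {}"
  then obtain i where i: "i \<in> Ip" "i \<in> Im" by blast
  obtain \<omega> where \<omega>: "\<omega> \<in> space M" using not_empty by blast
  from in_components_nonempty[OF component(1)[OF \<omega> i(1)]] obtain x where "x \<in> U i \<omega>" by blast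
  then have "0 < a x \<omega>" "a x \<omega> < 0"
    using in_components_subset[OF component(1)[OF \<omega> i(1)]] in_components_subset[OF component(2)[OF \<omega> i(2)]] by blast+
  then show False by simp
qed

lemma positive_component_sign:
  assumes i: "i \<in> Ip \<union> Im" and s: "s = (if i \<in> Ip then 1 else - 1)"
  obtains C where "\<And>\<omega>. \<omega> \<in> space M \<Longrightarrow> positive_component L (\<lambda>y. s * a y \<omega>) (U i \<omega>) C"
proof -
  obtain C where C: "\<And>\<omega> y. \<omega> \<in> space M \<Longrightarrow> \<bar>a y \<omega>\<bar> \<le> C" using equi_bounded by blast
  have "positive_component L (\<lambda>y. s * a y \<omega>) (U i \<omega>) C" if \<omega>: "\<omega> \<in> space M" for \<omega>
  proof
    show "open (U i \<omega>)" by (rule open_U[OF i \<omega>])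
    show "U i \<omega> \<noteq> {}" using component[OF \<omega>] i in_components_nonempty by blast
    show "0 < s * a x \<omega>" if "x \<in> U i \<omega>" for x
    proof (cases "i \<in> Ip")
      case True
      then show ?thesis using in_components_subset[OF component(1)[OF \<omega> True]] that s by auto
    next
      case False
      then have "i \<in> Im" using i by blast
      then show ?thesis using in_components_subset[OF component(2)[OF \<omega>]] that s False by auto
    qed
    show "s * a x \<omega> = 0" if "x \<in> frontier (U i \<omega>)" for x
      using frontier_components[OF i \<omega>] zero_set[OF \<omega>] that by auto
    show "s * a x \<omega> \<le> C" for x using C[OF \<omega>, of x] s by (auto split: if_splits)
    show "L-lipschitz_on UNIV (\<lambda>y. s * a y \<omega>)"
      using equi_lipschitz[OF \<omega>] lipschitz_on_minus[OF equi_lipschitz[OF \<omega>]] s by simp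
  qed
  then show ?thesis by (rule that)
qed

end

theorem theorem1:
  fixes M :: "'w measure"
    and \<tau> :: "real^'n \<Rightarrow> 'w \<Rightarrow> 'w"
    and a :: "real^'n \<Rightarrow> 'w \<Rightarrow> real"
    and L :: real
    and Ip Im :: "'i::zero set"
    and U :: "'i \<Rightarrow> 'w \<Rightarrow> (real^'n) set"
    and \<U> :: "'i \<Rightarrow> 'w set"
    and \<theta> :: "'i \<Rightarrow> real"
    and \<delta>0 :: "'i \<Rightarrow> 'w \<Rightarrow> real"
  assumes "component_medium M \<tau> a L Ip Im U \<U> \<theta> \<delta>0"
  shows "\<forall>i \<in> Ip \<union> Im. \<exists>H :: real^'n \<Rightarrow> real.
    continuous_on UNIV H \<and>
    (\<forall>r p. r \<ge> 0 \<longrightarrow> H (r *\<^sub>R p) = r * H p) \<and>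
    (AE \<omega> in M. bounded (U i \<omega>) \<longrightarrow> (\<forall>p. H p = 0)) \<and>
    (i \<in> Ip \<longrightarrow> (AE \<omega> in M. \<not> bounded (U i \<omega>) \<longrightarrow>
      convex_on UNIV H \<and> (\<forall>p. H p \<ge> 0) \<and>
      (\<forall>p. ereal (H p) =
        Inf {esssup (lebesgue_on (U i \<omega>)) (\<lambda>y. ereal (a y \<omega> * norm (p + grad w y))) | w lam.
          w \<in> S_plus \<and> lam > 0 \<and> (\<lambda>y. w y + p \<bullet> y) \<in> L_mu lam (\<lambda>y. a y \<omega>) (U i \<omega>)}))) \<and>
    (i \<in> Im \<longrightarrow> (AE \<omega> in M. \<not> bounded (U i \<omega>) \<longrightarrow>
      concave_on UNIV H \<and> (\<forall>p. H p \<le> 0) \<and>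
      (\<forall>p. ereal (H p) =
        Sup {essinf (lebesgue_on (U i \<omega>)) (\<lambda>y. ereal (a y \<omega> * norm (p + grad w y))) | w lam.
          w \<in> S_minus \<and> lam > 0 \<and> (\<lambda>y. w y + p \<bullet> y) \<in> L_mu lam (\<lambda>y. a y \<omega>) (U i \<omega>)})))"
proof
  interpret component_medium M \<tau> a L Ip Im U \<U> \<theta> \<delta>0 by fact
  fix i assume i: "i \<in> Ip \<union> Im"
  define s :: real where "s = (if i \<in> Ip then 1 else - 1)"
  obtain C where pc: "\<And>\<omega>. \<omega> \<in> space M \<Longrightarrow> positive_component L (\<lambda>y. s * a y \<omega>) (U i \<omega>) C"
    using positive_component_sign[OF i s_def] by blast
  obtain \<omega>0 where \<omega>0: "\<omega>0 \<in> space M"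
    "AE \<omega> in M. ham L (cutoff (\<lambda>y. s * a y \<omega>) (U i \<omega>)) = ham L (cutoff (\<lambda>y. s * a y \<omega>0) (U i \<omega>0))"
    using deterministic_cutoff[OF i pc] by blast
  interpret pc0: positive_component L "\<lambda>y. s * a y \<omega>0" "U i \<omega>0" C by (rule pc[OF \<omega>0(1)])
  \<comment> \<open>Freezing one realization makes \<open>h\<close> deterministic by construction;
    \<open>h_eq\<close> says that almost every realization yields the same function.\<close>
  define h where "h = ham L (cutoff (\<lambda>y. s * a y \<omega>0) (U i \<omega>0))"
  have h_scale: "h (r *\<^sub>R p) = r * h p" if "r \<ge> 0" for r p
    unfolding h_def by (rule pc0.ham_scaleR[OF that])
  have cont: "continuous_on UNIV h"
    unfolding h_def by (rule lipschitz_on_continuous_on[OF pc0.lipschitz_ham])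
  have h_eq: "AE \<omega> in M. \<omega> \<in> space M \<and> ham L (cutoff (\<lambda>y. s * a y \<omega>) (U i \<omega>)) = h"
    using \<omega>0(2) AE_space by eventually_elim (simp add: h_def)
  have h_nonneg: "0 \<le> h p" for p unfolding h_def by (rule pc0.ham_nonneg)
  have convex: "convex_on UNIV h" unfolding h_def by (rule pc0.convex_on_ham)
  \<comment> \<open>Boundedness is almost surely decided, so the clauses of the opposite alternative
    hold almost surely by a false premise. In the bounded case \<open>H\<close> can thus simply be
    0.\<close>
  from bounded_zero_one[OF i] consider (bounded) "AE \<omega> in M. bounded (U i \<omega>)"
    | (Ip) "AE \<omega> in M. \<not> bounded (U i \<omega>)" "i \<in> Ip" | (Im) "AE \<omega> in M. \<not> bounded (U i \<omega>)" "i \<in> Im"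
    using i by blast
  then show "\<exists>H :: real^'n \<Rightarrow> real.
    continuous_on UNIV H \<and>
    (\<forall>r p. r \<ge> 0 \<longrightarrow> H (r *\<^sub>R p) = r * H p) \<and>
    (AE \<omega> in M. bounded (U i \<omega>) \<longrightarrow> (\<forall>p. H p = 0)) \<and>
    (i \<in> Ip \<longrightarrow> (AE \<omega> in M. \<not> bounded (U i \<omega>) \<longrightarrow>
      convex_on UNIV H \<and> (\<forall>p. H p \<ge> 0) \<and>
      (\<forall>p. ereal (H p) =
        Inf {esssup (lebesgue_on (U i \<omega>)) (\<lambda>y. ereal (a y \<omega> * norm (p + grad w y))) | w lam.
          w \<in> S_plus \<and> lam > 0 \<and> (\<lambda>y. w y + p \<bullet> y) \<in> L_mu lam (\<lambda>y. a y \<omega>) (U i \<omega>)}))) \<and>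
    (i \<in> Im \<longrightarrow> (AE \<omega> in M. \<not> bounded (U i \<omega>) \<longrightarrow>
      concave_on UNIV H \<and> (\<forall>p. H p \<le> 0) \<and>
      (\<forall>p. ereal (H p) =
        Sup {essinf (lebesgue_on (U i \<omega>)) (\<lambda>y. ereal (a y \<omega> * norm (p + grad w y))) | w lam.
          w \<in> S_minus \<and> lam > 0 \<and> (\<lambda>y. w y + p \<bullet> y) \<in> L_mu lam (\<lambda>y. a y \<omega>) (U i \<omega>)})))"
  proof cases
    case bounded
    show ?thesis
      by (intro exI[of _ "\<lambda>_. 0"] conjI) (use bounded in \<open>auto elim!: eventually_mono\<close>)
  next
    case Ip
    have s: "s = 1" using Ip(2) by (simp add: s_def)
    have "AE \<omega> in M. \<not> bounded (U i \<omega>) \<longrightarrow>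
        convex_on UNIV h \<and> (\<forall>p. h p \<ge> 0) \<and>
          (\<forall>p. ereal (h p) =
            Inf {esssup (lebesgue_on (U i \<omega>)) (\<lambda>y. ereal (a y \<omega> * norm (p + grad w y))) | w lam.
              w \<in> S_plus \<and> lam > 0 \<and> (\<lambda>y. w y + p \<bullet> y) \<in> L_mu lam (\<lambda>y. a y \<omega>) (U i \<omega>)})
"
      using h_eq
    proof eventually_elim
      case (elim \<omega>)
      interpret positive_component L "\<lambda>y. a y \<omega>" "U i \<omega>" C
        using pc[of \<omega>] elim by (simp add: s)
      have "ereal (h p) = (INF w\<in>S_plus. esssup (lebesgue_on (U i \<omega>)) (\<lambda>y. ereal (a y \<omega> * norm (p + grad w y))))" for p
        using ham_eq_Inf_esssup[of p] elim by (simp add: s)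
      then show ?case unfolding image_S_class_eq[OF S_plus_subset_Lip] using convex h_nonneg by blast
    qed
    moreover have "AE \<omega> in M. bounded (U i \<omega>) \<longrightarrow> (\<forall>p. h p = 0)"
      using Ip(1) by eventually_elim blast
    moreover have "i \<notin> Im" using Ip(2) disjoint_indices by blast
    ultimately show ?thesis using cont h_scale by (intro exI[of _ h] conjI) blast+
  next
    case Im
    \<comment> \<open>The sign changes of \<open>uminus_ham_eq_Sup_essinf\<close>, in value and
      argument, turn the convex nonnegative \<open>h\<close> into a concave nonpositive
      function.\<close>
    define H where "H p = - h (- p)" for p
    have not_Ip: "i \<notin> Ip" using Im(2) disjoint_indices by blast
    then have s: "s = - 1" by (simp add: s_def)
    have "AE \<omega> in M. \<not> bounded (U i \<omega>) \<longrightarrow>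
        concave_on UNIV H \<and> (\<forall>p. H p \<le> 0) \<and>
          (\<forall>p. ereal (H p) =
            Sup {essinf (lebesgue_on (U i \<omega>)) (\<lambda>y. ereal (a y \<omega> * norm (p + grad w y))) | w lam.
              w \<in> S_minus \<and> lam > 0 \<and> (\<lambda>y. w y + p \<bullet> y) \<in> L_mu lam (\<lambda>y. a y \<omega>) (U i \<omega>)})
"
      using h_eq
    proof eventually_elim
      case (elim \<omega>)
      have pcm: "positive_component L (\<lambda>y. - a y \<omega>) (U i \<omega>) C"
        using pc[of \<omega>] elim by (simp add: s)
      have "ereal (H p) = (SUP w\<in>S_minus. essinf (lebesgue_on (U i \<omega>)) (\<lambda>y. ereal (a y \<omega> * norm (p + grad w y))))" for p
        using uminus_ham_eq_Sup_essinf[OF pcm, of p] elim by (simp add: s H_def)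
      moreover have "convex_on UNIV (\<lambda>p. h (- p))"
      proof (rule convex_onI)
        fix t :: real and p q :: "real^'n" assume "0 < t" "t < 1"
        then show "h (- ((1 - t) *\<^sub>R p + t *\<^sub>R q)) \<le> (1 - t) * h (- p) + t * h (- q)"
          using convex_onD[OF convex, of t "- p" "- q"] by simp
      qed simp
      then have "concave_on UNIV H" by (simp add: concave_on_def H_def)
      moreover have "H p \<le> 0" for p using h_nonneg by (simp add: H_def)
      ultimately show ?case unfolding image_S_class_eq[OF S_minus_subset_Lip] by blast
    qed
    moreover have "AE \<omega> in M. bounded (U i \<omega>) \<longrightarrow> (\<forall>p. H p = 0)"
      using Im(1) by eventually_elim blast
    moreover have "H (r *\<^sub>R p) = r * H p" if "0 \<le> r" for r p
      using h_scale[OF that, of "- p"] by (simp add: H_def)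
    moreover have "continuous_on UNIV H"
      unfolding H_def by (intro continuous_intros continuous_on_compose2[OF cont]) auto
    ultimately show ?thesis using not_Ip by (intro exI[of _ H] conjI) blast+
  qed
qed

end
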